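(* Let $V$ be a pure odd real vector space of dimension $m>4$ with a positive definite bilinear form $(\,,)$ that is symmetric in the ordinary sense, and let $\xi_1,\ldots,\xi_m$ be an orthonormal basis of $V$. Consider the invariant $(m-3)$-ary algebras $(V,\mu_v)$ with derived potentials $\mu_v=*(v)$, where $$v=a_1\xi_1\xi_2+a_2\xi_3\xi_4+\cdots+a_k\xi_{2k-1}\xi_{2k},\qquad a_j\in\mathbb R,$$ with $0\le a_k\le a_{k-1}\le\cdots\le a_1$ if $m=2k+1$, and $|a_k|\le a_{k-1}\le\cdots\le a_1$ if $m=2k$. All these algebras satisfy, with $n=m-3$, the Jacobi identity $$\sum(-1)^{(I,J)}\{\{b_{i_1},\ldots,b_{i_n}\},b_{j_1},\ldots,b_{j_{n-1}}\}=0\qquad\text{for all } b_1,\ldots,b_{2n-1}\in V,$$ with the exception of the following cases (in which the identity fails): (1) $m=5$: the algebras with derived potential $*(a_1\xi_1\xi_2+a_2\xi_3\xi_4)$, where $a_1,a_2\ne0$; (2) $m=6$: the algebras with derived potentials $*(a_1\xi_1\xi_2+a_2\xi_3\xi_4)$ and $*(a_1\xi_1\xi_2+a_2\xi_3\xi_4+a_3\xi_5\xi_6)$, where all $a_i$ occurring are $\ne0$.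
   Context: In the Jacobi identity the sum is over all ordered multi-indices $I=(i_1<\cdots<i_n)$ and $J=(j_1<\cdots<j_{n-1})$ such that $(I,J)$ is a permutation of $(1,\ldots,2n-1)$, and $(-1)^{(I,J)}$ is the sign of this permutation. Since $V$ is pure odd, $S^pV$ is the ordinary exterior power $\bigwedge^pV$, with elements of parity $p\bmod2$, and $S^*V=\bigoplus_pS^pV$, $S^0V=\mathbb R$. The Poisson bracket $[\,,]$ on $S^*V$ is the bilinear operation, zero when one argument is a scalar, determined by $[x,y]=(x,y)$ for $x,y\in V$, $[v,w_1w_2]=[v,w_1]w_2+(-1)^{pq}w_1[v,w_2]$ for $v\in S^pV$, $w_1\in S^qV$, and $[v,w]=-(-1)^{pq}[w,v]$ for $v\in S^pV$, $w\in S^qV$. The $n$-ary algebra $(V,\mu)$ with derived potential $\mu\in S^{n+1}V$ has the alternating multiplication $\{b_1,\ldots,b_n\}=[b_1,[\ldots,[b_n,\mu]\ldots]]$, $b_i\in V$. With $L=\xi_1\cdots\xi_m$, the linear map $*:S^pV\to S^{m-p}V$ is given by $*(x_1\cdots x_p)=[x_1,[\ldots,[x_p,L]\ldots]]$ for $x_i\in V$. *)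

theory Defs
  imports "HOL-Analysis.Analysis" "HOL-Combinatorics.Permutations"
begin

section \<open>The exterior algebra\<close>

text \<open>
  For a pure odd space \<open>V\<close> (here a type \<open>'v\<close>, in the ordinary, ungraded sense) the algebra
  \<open>S\<^sup>*V\<close> is the exterior algebra of \<open>V\<close>. It is presented by generators and relations: terms over
  \<open>V\<close> and the scalars, modulo the congruence generated by the laws of an associative unital real
  algebra, linearity of the inclusion of \<open>V\<close>, and \<open>x x = 0\<close> for \<open>x \<in> V\<close>.
\<close>

datatype 'v ext_term =
    Gen 'v
  | Scal real
  | Add "'v ext_term" "'v ext_term"
  | Mul "'v ext_term" "'v ext_term"

inductive ext_rel :: "'v::real_vector ext_term \<Rightarrow> 'v ext_term \<Rightarrow> bool" where
  rel_refl: "ext_rel s s"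
| rel_sym: "ext_rel s t \<Longrightarrow> ext_rel t s"
| rel_trans: "ext_rel s t \<Longrightarrow> ext_rel t u \<Longrightarrow> ext_rel s u"
| rel_Add: "ext_rel s s' \<Longrightarrow> ext_rel t t' \<Longrightarrow> ext_rel (Add s t) (Add s' t')"
| rel_Mul: "ext_rel s s' \<Longrightarrow> ext_rel t t' \<Longrightarrow> ext_rel (Mul s t) (Mul s' t')"
| add_ass: "ext_rel (Add (Add s t) u) (Add s (Add t u))"
| add_com: "ext_rel (Add s t) (Add t s)"
| add_zero: "ext_rel (Add (Scal 0) t) t"
| mul_ass: "ext_rel (Mul (Mul s t) u) (Mul s (Mul t u))"
| mul_one: "ext_rel (Mul (Scal 1) t) t"
| mul_zero: "ext_rel (Mul (Scal 0) t) (Scal 0)"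
| distl: "ext_rel (Mul s (Add t u)) (Add (Mul s t) (Mul s u))"
| distr: "ext_rel (Mul (Add s t) u) (Add (Mul s u) (Mul t u))"
| scal_add: "ext_rel (Scal (c + d)) (Add (Scal c) (Scal d))"
| scal_mul: "ext_rel (Scal (c * d)) (Mul (Scal c) (Scal d))"
| scal_central: "ext_rel (Mul (Scal c) t) (Mul t (Scal c))"
| gen_add: "ext_rel (Gen (x + y)) (Add (Gen x) (Gen y))"
| gen_scal: "ext_rel (Gen (c *\<^sub>R x)) (Mul (Scal c) (Gen x))"
| gen_sq: "ext_rel (Mul (Gen x) (Gen x)) (Scal 0)"

quotient_type (overloaded) 'v ext = "'v::real_vector ext_term" / ext_rel
proof (rule equivpI)
  show "reflp ext_rel" by (simp add: reflp_def rel_refl)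
  show "symp ext_rel" by (auto simp: symp_def intro: rel_sym)
  show "transp ext_rel" by (auto simp: transp_def intro: rel_trans)
qed

text \<open>The augmentation, which separates \<open>0\<close> from \<open>1\<close>.\<close>

primrec aug_term :: "'v ext_term \<Rightarrow> real" where
  "aug_term (Gen x) = 0"
| "aug_term (Scal c) = c"
| "aug_term (Add s t) = aug_term s + aug_term t"
| "aug_term (Mul s t) = aug_term s * aug_term t"

lemma aug_term_rel: "ext_rel s t \<Longrightarrow> aug_term s = aug_term t"
  by (induction rule: ext_rel.induct) (auto simp: algebra_simps)

instantiation ext :: (real_vector) real_algebra_1
begin

lift_definition zero_ext :: "'a ext" is "Scal 0" .
lift_definition one_ext :: "'a ext" is "Scal 1" .
lift_definition plus_ext :: "'a ext \<Rightarrow> 'a ext \<Rightarrow> 'a ext" is Add by (rule rel_Add)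
lift_definition times_ext :: "'a ext \<Rightarrow> 'a ext \<Rightarrow> 'a ext" is Mul by (rule rel_Mul)
lift_definition scaleR_ext :: "real \<Rightarrow> 'a ext \<Rightarrow> 'a ext" is "\<lambda>c. Mul (Scal c)"
  by (rule rel_Mul[OF rel_refl])
definition uminus_ext :: "'a ext \<Rightarrow> 'a ext" where "- v = (-1) *\<^sub>R v" for v :: "'a ext"
definition minus_ext :: "'a ext \<Rightarrow> 'a ext \<Rightarrow> 'a ext" where "v - w = v + - w" for v w :: "'a ext"

instance
proof
  fix u v w :: "'a ext" and c d :: real
  show "u + v + w = u + (v + w)" by transfer (rule add_ass)
  show "u + v = v + u" by transfer (rule add_com)
  show zl: "0 + u = u" by transfer (rule add_zero)
  show "u - v = u + - v" by (rule minus_ext_def)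
  show mass: "u * v * w = u * (v * w)" by transfer (rule mul_ass)
  show ml: "1 * u = u" by transfer (rule mul_one)
  show "u * 1 = u" by transfer (meson mul_one scal_central rel_sym rel_trans)
  show dr: "(u + v) * w = u * w + v * w" by transfer (rule distr)
  show "u * (v + w) = u * v + u * w" by transfer (rule distl)
  show "c *\<^sub>R (u + v) = c *\<^sub>R u + c *\<^sub>R v" by transfer (rule distl)
  show sd: "(c + d) *\<^sub>R u = c *\<^sub>R u + d *\<^sub>R u" for c d and u :: "'a ext"
    by transfer (meson scal_add rel_Mul rel_refl distr rel_trans)
  show "c *\<^sub>R d *\<^sub>R u = (c * d) *\<^sub>R u"
    by transfer (meson scal_mul rel_Mul rel_refl mul_ass rel_trans rel_sym)
  show s1: "1 *\<^sub>R u = u" for u :: "'a ext" by transfer (rule mul_one)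
  show "c *\<^sub>R u * v = c *\<^sub>R (u * v)" by transfer (rule mul_ass)
  show "u * c *\<^sub>R v = c *\<^sub>R (u * v)"
    by transfer (meson mul_ass scal_central rel_Mul rel_refl rel_trans rel_sym)
  have "0 *\<^sub>R u = 0" by transfer (rule mul_zero)
  then show "- u + u = 0"
    using sd[of "-1" 1 u] by (simp add: uminus_ext_def s1)
  show "(0::'a ext) \<noteq> 1"
    by transfer (auto dest: aug_term_rel)
qed

end

text \<open>The inclusion of \<open>V\<close>.\<close>

lift_definition \<iota> :: "'v::real_vector \<Rightarrow> 'v ext" is Gen .

lemma iota_add: "\<iota> (x + y) = \<iota> x + \<iota> y"
  by transfer (rule gen_add)

lemma iota_scaleR: "\<iota> (c *\<^sub>R x) = c *\<^sub>R \<iota> x"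
  by transfer (rule gen_scal)

lemma linear_iota: "linear \<iota>"
  by (rule linearI) (simp_all add: iota_add iota_scaleR)

lemma iota_sq [simp]: "\<iota> x * \<iota> x = 0"
  by transfer (rule gen_sq)

lemma iota_anticomm: "\<iota> x * \<iota> y = - (\<iota> y * \<iota> x)"
proof -
  have "0 = \<iota> (x + y) * \<iota> (x + y)" by simp
  also have "\<dots> = \<iota> x * \<iota> y + \<iota> y * \<iota> x"
    by (simp only: iota_add distrib_left distrib_right) simp
  finally show ?thesis by (simp add: eq_neg_iff_add_eq_0)
qed

lemma abs_Scal: "abs_ext (Scal c) = of_real c"
proof -
  have "c *\<^sub>R (1 :: 'a ext) = abs_ext (Mul (Scal c) (Scal 1))"
    by (simp add: one_ext_def scaleR_ext.abs_eq)
  also have "\<dots> = abs_ext (Scal c)"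
    by (metis ext.abs_eq_iff mult.right_neutral rel_sym scal_mul)
  finally show ?thesis by (simp add: of_real_def)
qed

lemma ext_induct [case_names gen scal add mult]:
  fixes w :: "'v::real_vector ext"
  assumes "\<And>x. P (\<iota> x)" "\<And>c. P (of_real c)"
    and "\<And>v w. P v \<Longrightarrow> P w \<Longrightarrow> P (v + w)" "\<And>v w. P v \<Longrightarrow> P w \<Longrightarrow> P (v * w)"
  shows "P w"
proof -
  have "P (abs_ext t)" for t
  proof (induction t)
    case (Gen x) then show ?case using assms(1)[of x] by (simp add: \<iota>.abs_eq)
  next
    case (Scal c) then show ?case using assms(2) by (simp add: abs_Scal)
  next
    case (Add s t) then show ?case using assms(3) by (metis plus_ext.abs_eq)
  next
    case (Mul s t) then show ?case using assms(4) by (metis times_ext.abs_eq)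
  qed
  then show ?thesis by (induct w rule: ext.abs_induct)
qed

text \<open>The monomial \<open>x\<^sub>1\<cdots>x\<^sub>p\<close> and the homogeneous component \<open>S\<^sup>pV\<close>.\<close>

definition monomial :: "'v::real_vector list \<Rightarrow> 'v ext" where
  "monomial xs = prod_list (map \<iota> xs)"

definition ext_pow :: "nat \<Rightarrow> 'v::real_vector ext set" where
  "ext_pow p = span {monomial xs | xs. length xs = p}"

lemma monomial_simps [simp]: "monomial [] = 1" "monomial (x # xs) = \<iota> x * monomial xs"
  "monomial (xs @ ys) = monomial xs * monomial ys"
  by (simp_all add: monomial_def)

lemma monomial_in_S: "monomial xs \<in> ext_pow (length xs)"
  unfolding ext_pow_def by (rule span_base) auto

lemma iota_in_S: "\<iota> x \<in> ext_pow 1"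
  using monomial_in_S[of "[x]"] by simp

lemma of_real_in_S: "of_real c \<in> ext_pow 0"
proof -
  have "monomial [] \<in> ext_pow 0" using monomial_in_S[of "[]"] by simp
  then have "c *\<^sub>R monomial [] \<in> ext_pow 0" unfolding ext_pow_def by (rule span_scale)
  then show ?thesis by (simp add: of_real_def)
qed

lemma S_induct [consumes 1, case_names monomial zero add scale]:
  assumes "w \<in> ext_pow p"
    and "\<And>xs. length xs = p \<Longrightarrow> P (monomial xs)" "P 0"
    and "\<And>v w. P v \<Longrightarrow> P w \<Longrightarrow> P (v + w)" "\<And>c w. P w \<Longrightarrow> P (c *\<^sub>R w)"
  shows "P w"
proof -
  have "span {monomial xs | xs. length xs = p} \<subseteq> {w. P w}"
    by (rule span_minimal) (use assms in \<open>auto simp: subspace_def\<close>)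
  then show ?thesis using assms(1) by (auto simp: ext_pow_def)
qed

lemma S_mult:
  assumes "v \<in> ext_pow p" "w \<in> ext_pow q"
  shows "v * w \<in> ext_pow (p + q)"
  using assms(1)
proof (induction rule: S_induct)
  case (monomial xs)
  show ?case using assms(2)
  proof (induction rule: S_induct)
    case (monomial ys)
    then show ?case using monomial_in_S[of "xs @ ys"] \<open>length xs = p\<close> by simp
  qed (auto simp: ext_pow_def distrib_left span_zero intro: span_add span_scale)
qed (auto simp: ext_pow_def distrib_right span_zero intro: span_add span_scale)

lemma S_sum: "(\<And>i. i \<in> I \<Longrightarrow> f i \<in> ext_pow p) \<Longrightarrow> sum f I \<in> ext_pow p"
  unfolding ext_pow_def by (rule span_sum)

lemma span_monomial_UNIV: "span (range monomial) = (UNIV :: 'v::real_vector ext set)"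
proof -
  have "w \<in> span (range monomial)" for w :: "'v ext"
  proof (induction w rule: ext_induct)
    case (gen x)
    have "\<iota> x = monomial [x]" by simp
    then show ?case by (metis rangeI span_base)
  next
    case (scal c)
    have "of_real c = c *\<^sub>R (monomial [] :: 'v ext)" by (simp add: of_real_def)
    then show ?case by (metis rangeI span_base span_scale)
  next
    case (add v w) then show ?case by (rule span_add)
  next
    case (mult v w)
    have *: "monomial xs * w \<in> span (range monomial)" for xs :: "'v list"
      using mult(2)
    proof (induction rule: span_induct_alt)
      case (step c z y)
      then obtain ys where "z = monomial ys" by auto
      then have "monomial xs * z \<in> span (range monomial)"
        by (metis monomial_simps(3) rangeI span_base)
      with step show ?case by (simp add: distrib_left span_add span_scale)
    qed (simp add: span_zero)
    show ?case using mult(1)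
    proof (induction rule: span_induct_alt)
      case (step c z y)
      with * show ?case by (auto simp: distrib_right span_add span_scale)
    qed (simp add: span_zero)
  qed
  then show ?thesis by auto
qed

lemma linear_eq_on_monomial:
  fixes f g :: "'v::real_vector ext \<Rightarrow> 'b::real_vector"
  assumes "linear f" "linear g" "\<And>xs. f (monomial xs) = g (monomial xs)"
  shows "f = g"
  using linear_eq_on_span[OF assms(1,2), of "range monomial"] assms(3)
  by (auto simp: span_monomial_UNIV)

subsection \<open>Parity involution and contraction\<close>

primrec hat_term :: "'v::real_vector ext_term \<Rightarrow> 'v ext" where
  "hat_term (Gen x) = - \<iota> x"
| "hat_term (Scal c) = of_real c"
| "hat_term (Add s t) = hat_term s + hat_term t"
| "hat_term (Mul s t) = hat_term s * hat_term t"

lemma hat_term_rel: "ext_rel s t \<Longrightarrow> hat_term s = hat_term t"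
  by (induction rule: ext_rel.induct)
     (auto simp: algebra_simps iota_add iota_scaleR of_real_def)

lift_definition hat :: "'v::real_vector ext \<Rightarrow> 'v ext" is hat_term
  by (rule hat_term_rel)

lemma hat_iota [simp]: "hat (\<iota> x) = - \<iota> x"
  by (simp add: \<iota>.abs_eq hat.abs_eq)

lemma hat_of_real [simp]: "hat (of_real c) = of_real c"
  using hat.abs_eq[of "Scal c"] by (simp add: abs_Scal)

lemma hat_add: "hat (v + w) = hat v + hat w"
  by (induct v rule: ext.abs_induct, induct w rule: ext.abs_induct)
     (simp add: plus_ext.abs_eq hat.abs_eq)

lemma hat_mult: "hat (v * w) = hat v * hat w"
  by (induct v rule: ext.abs_induct, induct w rule: ext.abs_induct)
     (simp add: times_ext.abs_eq hat.abs_eq)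

primrec con_term :: "'v::euclidean_space \<Rightarrow> 'v ext_term \<Rightarrow> 'v ext" where
  "con_term z (Gen x) = of_real (z \<bullet> x)"
| "con_term z (Scal c) = 0"
| "con_term z (Add s t) = con_term z s + con_term z t"
| "con_term z (Mul s t) = con_term z s * abs_ext t + hat_term s * con_term z t"

lemma con_term_rel: "ext_rel s t \<Longrightarrow> con_term z s = con_term z t"
proof (induction rule: ext_rel.induct)
  case (rel_Mul s s' t t')
  then show ?case by (simp add: hat_term_rel ext.abs_eq_iff[THEN iffD2])
qed (auto simp: algebra_simps iota_add iota_scaleR inner_add_right of_real_def
       plus_ext.abs_eq[symmetric] times_ext.abs_eq[symmetric] \<iota>.abs_eq[symmetric] abs_Scal)

lift_definition con :: "'v::euclidean_space \<Rightarrow> 'v ext \<Rightarrow> 'v ext" is con_term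
  by (rule con_term_rel)

lemma con_iota [simp]: "con z (\<iota> x) = of_real (z \<bullet> x)"
  by (simp add: \<iota>.abs_eq con.abs_eq)

lemma con_of_real [simp]: "con z (of_real c) = 0"
  by (simp add: abs_Scal[symmetric] con.abs_eq)

lemma con_add: "con z (v + w) = con z v + con z w"
  by (induct v rule: ext.abs_induct, induct w rule: ext.abs_induct)
     (simp add: plus_ext.abs_eq con.abs_eq)

lemma con_mult: "con z (v * w) = con z v * w + hat v * con z w"
  by (induct v rule: ext.abs_induct, induct w rule: ext.abs_induct)
     (simp add: times_ext.abs_eq con.abs_eq hat.abs_eq)

lemma hat_scaleR: "hat (c *\<^sub>R v) = c *\<^sub>R hat v"
  using hat_mult[of "of_real c" v] by (simp only: hat_of_real) (simp add: of_real_def)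

lemma con_scaleR: "con z (c *\<^sub>R v) = c *\<^sub>R con z v"
  using con_mult[of z "of_real c" v] by (simp only: hat_of_real con_of_real) (simp add: of_real_def)

lemma linear_hat: "linear hat"
  by (rule linearI) (simp_all add: hat_add hat_scaleR)

lemma linear_con: "linear (con z)"
  by (rule linearI) (simp_all add: con_add con_scaleR)

lemmas hat_linear_simps =
  linear_0[OF linear_hat] linear_neg[OF linear_hat] linear_diff[OF linear_hat]
lemmas con_linear_simps =
  linear_0[OF linear_con] linear_neg[OF linear_con] linear_diff[OF linear_con]

lemma hat_one [simp]: "hat 1 = 1" and con_one [simp]: "con z 1 = 0"
  using hat_of_real[of 1] con_of_real[of z 1] by simp_all

lemma con_add_left: "con (y + z) w = con y w + con z w"
  by (induction w rule: ext_induct)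
     (simp_all add: con_add con_mult inner_add_left algebra_simps)

lemma con_scaleR_left: "con (c *\<^sub>R z) w = c *\<^sub>R con z w"
  by (induction w rule: ext_induct)
     (simp_all add: con_add con_mult algebra_simps, simp add: of_real_def)

lemma hat_hat [simp]: "hat (hat w) = w"
  by (induction w rule: ext_induct) (simp_all add: hat_add hat_mult hat_linear_simps)

lemma con_hat: "con z (hat w) = - hat (con z w)"
  by (induction w rule: ext_induct)
     (simp_all add: hat_add hat_mult con_add con_mult con_linear_simps hat_linear_simps)

lemma con_con [simp]: "con z (con z w) = 0"
  by (induction w rule: ext_induct)
     (simp_all add: con_add con_mult con_hat con_linear_simps)

lemma hat_S: "w \<in> ext_pow p \<Longrightarrow> hat w = (-1) ^ p *\<^sub>R w"
proof (induction rule: S_induct)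
  case (monomial xs)
  then show ?case by (induction xs arbitrary: p) (auto simp: hat_mult)
qed (simp_all add: hat_linear_simps hat_add hat_scaleR algebra_simps)

lemma con_S_0: "w \<in> ext_pow 0 \<Longrightarrow> con z w = 0"
  by (induction rule: S_induct) (simp_all add: con_linear_simps con_add con_scaleR)

lemma con_S_Suc: "w \<in> ext_pow (Suc p) \<Longrightarrow> con z w \<in> ext_pow p"
proof (induction rule: S_induct)
  case (monomial xs)
  then show ?case
  proof (induction xs arbitrary: p)
    case (Cons x xs)
    have 1: "of_real (z \<bullet> x) * monomial xs \<in> ext_pow p"
      using S_mult[OF of_real_in_S monomial_in_S[of xs]] Cons.prems by simp
    have 2: "\<iota> x * con z (monomial xs) \<in> ext_pow p"
    proof (cases p)
      case 0
      then show ?thesis using Cons.prems by (simp add: ext_pow_def span_zero)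
    next
      case (Suc q)
      then show ?thesis using S_mult[OF iota_in_S Cons.IH[of q]] Cons.prems by simp
    qed
    show ?case using 1 2 by (simp add: con_mult ext_pow_def span_diff)
  qed simp
qed (auto simp: ext_pow_def con_linear_simps con_add con_scaleR span_zero intro: span_add span_scale)

lemma S_commute:
  assumes "v \<in> ext_pow p" "w \<in> ext_pow q"
  shows "v * w = (-1) ^ (p * q) *\<^sub>R (w * v)"
proof -
  have *: "\<iota> x * monomial ys = (-1) ^ length ys *\<^sub>R (monomial ys * \<iota> x)" for x :: 'a and ys
  proof (induction ys)
    case (Cons y ys)
    have "\<iota> x * monomial (y # ys) = - (\<iota> y * (\<iota> x * monomial ys))"
      by (simp add: iota_anticomm[of x y] flip: mult.assoc)
    with Cons show ?case by (simp add: mult.assoc)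
  qed simp
  have **: "monomial xs * monomial ys = (-1) ^ (length xs * length ys) *\<^sub>R (monomial ys * monomial xs)"
    for xs ys :: "'a list"
  proof (induction xs)
    case (Cons x xs)
    have "monomial (x # xs) * monomial ys = (-1) ^ (length xs * length ys) *\<^sub>R (\<iota> x * monomial ys * monomial xs)"
      by (simp add: mult.assoc Cons)
    also have "\<iota> x * monomial ys * monomial xs = (-1) ^ length ys *\<^sub>R (monomial ys * monomial (x # xs))"
      by (simp only: * monomial_simps mult_scaleR_left mult.assoc)
    also have "(-1) ^ (length xs * length ys) *\<^sub>R \<dots> =
        (-1) ^ (length (x # xs) * length ys) *\<^sub>R (monomial ys * monomial (x # xs))"
      by (simp add: power_add mult.commute)
    finally show ?case .
  qed simp
  show ?thesis using assms(1)
  proof (induction rule: S_induct)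
    case (monomial xs)
    show ?case using assms(2)
    proof (induction rule: S_induct)
      case (monomial ys)
      then show ?case using ** \<open>length xs = p\<close> by metis
    qed (auto simp: distrib_left distrib_right scaleR_add_right)
  qed (auto simp: distrib_left distrib_right scaleR_add_right)
qed

section \<open>Poisson bracket, duality map and derived algebra\<close>

definition poisson_bracket ::
    "('v::euclidean_space ext \<Rightarrow> 'v ext \<Rightarrow> 'v ext) \<Rightarrow> bool" where
  "poisson_bracket br \<longleftrightarrow>
     bilinear br \<and>
     (\<forall>c w. br (of_real c) w = 0 \<and> br w (of_real c) = 0) \<and>
     (\<forall>x y. br (\<iota> x) (\<iota> y) = of_real (x \<bullet> y)) \<and>
     (\<forall>p q. \<forall>v\<in>ext_pow p. \<forall>w1\<in>ext_pow q. \<forall>w2.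
        br v (w1 * w2) = br v w1 * w2 + (-1) ^ (p * q) * (w1 * br v w2)) \<and>
     (\<forall>p q. \<forall>v\<in>ext_pow p. \<forall>w\<in>ext_pow q. br v w = - ((-1) ^ (p * q) * br w v))"

text \<open>These properties determine the bracket: see \<open>ex1_poisson_bracket\<close> below.\<close>

definition poisson :: "'v::euclidean_space ext \<Rightarrow> 'v ext \<Rightarrow> 'v ext" where
  "poisson = (THE br. poisson_bracket br)"

lemma poisson_bracket_bilinear: "poisson_bracket br \<Longrightarrow> bilinear br"
  and poisson_bracket_iota: "poisson_bracket br \<Longrightarrow> br (\<iota> x) (\<iota> y) = of_real (x \<bullet> y)"
  and poisson_bracket_scal:
    "poisson_bracket br \<Longrightarrow> br (of_real c) w = 0" "poisson_bracket br \<Longrightarrow> br w (of_real c) = 0"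
  and poisson_bracket_mult: "poisson_bracket br \<Longrightarrow> v \<in> ext_pow p \<Longrightarrow> w1 \<in> ext_pow q \<Longrightarrow>
    br v (w1 * w2) = br v w1 * w2 + (-1) ^ (p * q) * (w1 * br v w2)"
  and poisson_bracket_sym: "poisson_bracket br \<Longrightarrow> v \<in> ext_pow p \<Longrightarrow> w \<in> ext_pow q \<Longrightarrow>
    br v w = - ((-1) ^ (p * q) * br w v)"
  unfolding poisson_bracket_def by blast+

lemma minus_one_power_mult: "(-1) ^ n * (w :: 'a::real_algebra_1) = (-1) ^ n *\<^sub>R w"
  by (cases "even n") auto

lemma poisson_bracket_unique:
  assumes 1: "poisson_bracket br1" and 2: "poisson_bracket br2"
  shows "br1 = br2"
proof -
  have a: "br1 (\<iota> x) (monomial ys) = br2 (\<iota> x) (monomial ys)" for x ys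
  proof (induction ys)
    case Nil
    then show ?case
      using poisson_bracket_scal(2)[OF 1, of "\<iota> x" 1] poisson_bracket_scal(2)[OF 2, of "\<iota> x" 1] by simp
  next
    case (Cons y ys)
    then show ?case
      using 1 2 by (simp add: poisson_bracket_mult[OF _ iota_in_S iota_in_S] poisson_bracket_iota)
  qed
  have b: "br1 (monomial xs) (\<iota> y) = br2 (monomial xs) (\<iota> y)" for xs y
    using poisson_bracket_sym[OF 1 monomial_in_S iota_in_S] poisson_bracket_sym[OF 2 monomial_in_S iota_in_S]
    by (simp add: a)
  have c: "br1 (monomial xs) (monomial ys) = br2 (monomial xs) (monomial ys)" for xs ys
  proof (induction ys)
    case Nil
    then show ?case
      using poisson_bracket_scal(2)[OF 1, of "monomial xs" 1] poisson_bracket_scal(2)[OF 2, of "monomial xs" 1]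
      by simp
  next
    case (Cons y ys)
    then show ?case
      using 1 2 by (simp add: poisson_bracket_mult[OF _ monomial_in_S iota_in_S] b)
  qed
  have lin: "linear (br v)" "linear (\<lambda>v. br v w)" if "poisson_bracket br" for br v w
    using poisson_bracket_bilinear[OF that] by (auto simp: bilinear_def)
  have d: "br1 (monomial xs) = br2 (monomial xs)" for xs
    by (rule linear_eq_on_monomial) (use lin 1 2 c in auto)
  have "(\<lambda>v. br1 v w) = (\<lambda>v. br2 v w)" for w
    by (rule linear_eq_on_monomial) (use lin 1 2 d in auto)
  then show ?thesis by (metis ext)
qed

lemma poisson_bracket_exists:
  "poisson_bracket (\<lambda>v w. - (\<Sum>b\<in>Basis. con b (hat v) * con b w))" (is "poisson_bracket ?br")
  unfolding poisson_bracket_def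
proof (intro conjI allI ballI)
  show "bilinear ?br"
    unfolding bilinear_def
    by (auto intro!: linearI simp: hat_add hat_scaleR con_add con_scaleR algebra_simps
          sum.distrib scaleR_right.sum)
next
  fix c and w :: "'a ext"
  show "?br (of_real c) w = 0" "?br w (of_real c) = 0" by simp_all
next
  fix x y :: 'a
  have "?br (\<iota> x) (\<iota> y) = of_real (\<Sum>b\<in>Basis. (x \<bullet> b) * (y \<bullet> b))"
    by (simp add: con_linear_simps sum_negf inner_commute)
  then show "?br (\<iota> x) (\<iota> y) = of_real (x \<bullet> y)"
    by (simp add: euclidean_inner[of x y])
next
  fix p q and v w1 w2 :: "'a ext"
  assume v: "v \<in> ext_pow p" and w1: "w1 \<in> ext_pow q"
  have com: "con b (hat v) * (hat w1 * u) = (-1) ^ (p * q) *\<^sub>R (w1 * (con b (hat v) * u))" for b u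
  proof (cases p)
    case 0
    then show ?thesis using v by (simp add: con_hat con_S_0 hat_linear_simps)
  next
    case (Suc p')
    have "hat v \<in> ext_pow p" using v by (simp add: hat_S ext_pow_def span_scale)
    then have "con b (hat v) \<in> ext_pow p'" using Suc con_S_Suc by blast
    from S_commute[OF this w1] show ?thesis
      by (simp add: hat_S[OF w1] Suc power_add flip: mult.assoc)
  qed
  have "con b (hat v) * con b (w1 * w2) =
      con b (hat v) * con b w1 * w2 + (-1) ^ (p * q) *\<^sub>R (w1 * (con b (hat v) * con b w2))" for b
    unfolding con_mult distrib_left com by (simp add: mult.assoc)
  then show "?br v (w1 * w2) = ?br v w1 * w2 + (-1) ^ (p * q) * (w1 * ?br v w2)"
    unfolding minus_one_power_mult
    by (simp add: sum.distrib sum_distrib_right sum_distrib_left scaleR_right.sum)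
next
  fix p q and v w :: "'a ext"
  assume v: "v \<in> ext_pow p" and w: "w \<in> ext_pow q"
  have "con b (hat v) * con b w = - ((-1) ^ (p * q) *\<^sub>R (con b (hat w) * con b v))" for b
  proof (cases "p = 0 \<or> q = 0")
    case True
    then show ?thesis using v w by (auto simp: con_hat con_S_0 hat_linear_simps)
  next
    case False
    then obtain p' q' where pq: "p = Suc p'" "q = Suc q'" by (metis not0_implies_Suc)
    have "con b v \<in> ext_pow p'" "con b w \<in> ext_pow q'" using v w pq con_S_Suc by blast+
    from S_commute[OF this] show ?thesis
      by (simp add: hat_S[OF v] hat_S[OF w] con_scaleR con_linear_simps pq power_add mult.commute)
  qed
  then show "?br v w = - ((-1) ^ (p * q) * ?br w v)"
    by (simp add: minus_one_power_mult sum_negf scaleR_right.sum)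
qed

theorem ex1_poisson_bracket: "\<exists>!br. poisson_bracket br"
  using poisson_bracket_exists poisson_bracket_unique by blast

lemma poisson_bracket_poisson: "poisson_bracket poisson"
  unfolding poisson_def by (rule theI'[OF ex1_poisson_bracket])

lemma poisson_eq: "poisson v w = - (\<Sum>b\<in>Basis. con b (hat v) * con b w)"
  using poisson_bracket_unique[OF poisson_bracket_poisson poisson_bracket_exists] by metis

lemma poisson_iota_left: "poisson (\<iota> x) w = con x w"
proof -
  have lin: "linear (\<lambda>z. con z w)"
    by (rule linearI) (simp_all add: con_add_left con_scaleR_left)
  have "con x w = con (\<Sum>b\<in>Basis. (x \<bullet> b) *\<^sub>R b) w" by (simp add: euclidean_representation)
  also have "\<dots> = (\<Sum>b\<in>Basis. (x \<bullet> b) *\<^sub>R con b w)"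
    by (simp add: linear_sum[OF lin] linear_scale[OF lin])
  finally show ?thesis
    by (simp add: poisson_eq con_linear_simps sum_negf inner_commute of_real_def)
qed

text \<open>\<open>brackets [w\<^sub>1, \<dots>, w\<^sub>p] \<mu> = [w\<^sub>1, [\<dots>, [w\<^sub>p, \<mu>]\<dots>]]\<close>\<close>

definition brackets :: "'v::euclidean_space ext list \<Rightarrow> 'v ext \<Rightarrow> 'v ext" where
  "brackets ws \<mu> = foldr poisson ws \<mu>"

definition orthonormal_basis :: "nat \<Rightarrow> (nat \<Rightarrow> 'v::euclidean_space) \<Rightarrow> bool" where
  "orthonormal_basis m \<xi> \<longleftrightarrow>
     (\<forall>i\<in>{1..m}. \<forall>j\<in>{1..m}. \<xi> i \<bullet> \<xi> j = (if i = j then 1 else 0)) \<and>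
     span (\<xi> ` {1..m}) = UNIV"

definition top_form :: "nat \<Rightarrow> (nat \<Rightarrow> 'v::euclidean_space) \<Rightarrow> 'v ext" where
  "top_form m \<xi> = monomial (map \<xi> [1..<Suc m])"

text \<open>
  The map \<open>*\<close> on all of \<open>S\<^sup>*V\<close>, relative to \<open>L\<close>; it is well defined for every \<open>L\<close>, see
  \<open>ex1_star\<close> below.
\<close>

definition star :: "'v::euclidean_space ext \<Rightarrow> 'v ext \<Rightarrow> 'v ext" where
  "star L = (THE f. linear f \<and> (\<forall>xs. f (monomial xs) = brackets (map \<iota> xs) L))"

primrec act_term :: "'v::euclidean_space ext_term \<Rightarrow> 'v ext \<Rightarrow> 'v ext" where
  "act_term (Gen x) w = con x w"
| "act_term (Scal c) w = c *\<^sub>R w"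
| "act_term (Add s t) w = act_term s w + act_term t w"
| "act_term (Mul s t) w = act_term s (act_term t w)"

lemma linear_act_term: "linear (act_term t)"
  by (induction t)
     (auto intro!: linearI simp: con_add con_scaleR linear_add linear_scale algebra_simps)

lemma act_term_rel: "ext_rel s t \<Longrightarrow> act_term s = act_term t"
  by (induction rule: ext_rel.induct)
     (auto simp: fun_eq_iff con_add_left con_scaleR_left algebra_simps
        linear_add[OF linear_act_term] linear_scale[OF linear_act_term])

lift_definition act :: "'v::euclidean_space ext \<Rightarrow> 'v ext \<Rightarrow> 'v ext" is act_term
  by (simp add: act_term_rel)

theorem ex1_star:
  "\<exists>!f. linear f \<and> (\<forall>xs. f (monomial xs) = brackets (map \<iota> xs) L)"
proof (rule ex1I)
  have add: "act (v + w) u = act v u + act w u" for v w u :: "'a ext"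
    by (induct v rule: ext.abs_induct, induct w rule: ext.abs_induct)
       (simp add: plus_ext.abs_eq act.abs_eq)
  have mult: "act (v * w) u = act v (act w u)" for v w u :: "'a ext"
    by (induct v rule: ext.abs_induct, induct w rule: ext.abs_induct)
       (simp add: times_ext.abs_eq act.abs_eq)
  have scal: "act (of_real c) u = c *\<^sub>R u" for c and u :: "'a ext"
    by (simp add: abs_Scal[symmetric] act.abs_eq)
  have scaleR: "act (c *\<^sub>R v) u = c *\<^sub>R act v u" for c and v u :: "'a ext"
    using mult[of "of_real c" v u] scal[of c] by (simp add: of_real_def)
  have gen: "act (\<iota> x) u = con x u" for x and u :: "'a ext"
    by (simp add: \<iota>.abs_eq act.abs_eq)
  have "act (monomial xs) L = brackets (map \<iota> xs) L" for xs
    using scal[of 1] by (induction xs) (simp_all add: brackets_def mult gen poisson_iota_left)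
  then show *: "linear (\<lambda>v. act v L) \<and> (\<forall>xs. act (monomial xs) L = brackets (map \<iota> xs) L)"
    by (auto intro!: linearI simp: add scaleR)
  fix f
  assume f: "linear f \<and> (\<forall>xs. f (monomial xs) = brackets (map \<iota> xs) L)"
  show "f = (\<lambda>v. act v L)"
    by (rule linear_eq_on_monomial) (use f * in auto)
qed

lemma linear_star: "linear (star L)"
  and star_monomial: "star L (monomial xs) = brackets (map \<iota> xs) L"
  using theI'[OF ex1_star[of L]] unfolding star_def by blast+

text \<open>
  The multiplication of the algebra with derived potential \<open>\<mu>\<close>. Both its arguments and, for
  \<open>\<mu> \<in> S\<^sup>n\<^sup>+\<^sup>1V\<close>, its values on \<open>n\<close> arguments are elements of \<open>V\<close>, regarded as a subspace of
  \<open>S\<^sup>*V\<close> via \<open>\<iota>\<close>.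
\<close>

definition derived_mult :: "'v::euclidean_space ext \<Rightarrow> 'v ext list \<Rightarrow> 'v ext" where
  "derived_mult \<mu> bs = brackets bs \<mu>"

lemma brackets_iota_S: "w \<in> ext_pow (length xs + p) \<Longrightarrow> brackets (map \<iota> xs) w \<in> ext_pow p"
  by (induction xs arbitrary: p)
     (auto simp: brackets_def poisson_iota_left intro!: con_S_Suc)

lemma S_1_eq: "ext_pow 1 = range \<iota>"
proof -
  have "{monomial xs | xs :: 'a list. length xs = 1} = range \<iota>"
    by (auto simp: length_Suc_conv) (metis One_nat_def length_Cons list.size(3) monomial_simps(1,2) mult.right_neutral)
  moreover have "span (range \<iota>) = range (\<iota> :: 'a \<Rightarrow> _)"
    by (rule span_eq_iff[THEN iffD2]) (rule linear_subspace_image[OF linear_iota subspace_UNIV])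
  ultimately show ?thesis by (simp add: ext_pow_def)
qed

lemma derived_mult_in_V:
  assumes "\<mu> \<in> ext_pow (length xs + 1)"
  shows "derived_mult \<mu> (map \<iota> xs) \<in> range \<iota>"
  using brackets_iota_S[OF assms] unfolding derived_mult_def S_1_eq .

lemma star_S:
  assumes "L \<in> ext_pow m" "v \<in> ext_pow p" "p \<le> m"
  shows "star L v \<in> ext_pow (m - p)"
  using assms(2)
proof (induction rule: S_induct)
  case (monomial xs)
  then show ?case using brackets_iota_S[of L xs "m - p"] assms by (simp add: star_monomial)
qed (auto simp: ext_pow_def linear_0[OF linear_star] linear_add[OF linear_star]
       linear_scale[OF linear_star] span_zero intro: span_add span_scale)

text \<open>
  The pairs \<open>(I, J)\<close> are given by the permutation \<open>\<sigma> = (I, J)\<close> itself, that is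
  \<open>i\<^sub>r = \<sigma> r\<close> for \<open>r \<le> n\<close> and \<open>j\<^sub>r = \<sigma> (n + r)\<close> for \<open>r \<le> n - 1\<close>.
\<close>

definition jacobi_perms :: "nat \<Rightarrow> (nat \<Rightarrow> nat) set" where
  "jacobi_perms n = {\<sigma>. \<sigma> permutes {1..2*n-1} \<and>
     strict_mono_on {1..n} \<sigma> \<and> strict_mono_on {n+1..2*n-1} \<sigma>}"

definition jacobi_identity :: "nat \<Rightarrow> 'v::euclidean_space ext \<Rightarrow> bool" where
  "jacobi_identity n \<mu> \<longleftrightarrow>
     (\<forall>b :: nat \<Rightarrow> 'v.
        (\<Sum>\<sigma>\<in>jacobi_perms n. of_int (sign \<sigma>) *
           derived_mult \<mu>
             (derived_mult \<mu> (map (\<lambda>r. \<iota> (b (\<sigma> r))) [1..<Suc n])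
              # map (\<lambda>r. \<iota> (b (\<sigma> r))) [Suc n..<2*n])) = 0)"

end

theory Submission
  imports Defs
begin

text \<open>
  The Jacobi sum is multilinear and alternating in \<open>b\<^sub>1, \<dots>, b\<^sub>2\<^sub>n\<^sub>-\<^sub>1\<close>, so it suffices to evaluate
  it on distinct basis vectors \<open>\<xi>\<^sub>c\<close>. There \<open>{\<xi>\<^sub>I}\<close> is a combination of the \<open>a\<^sub>j \<xi>\<^sub>t\<close> with
  \<open>t\<close> the only index outside \<open>I \<union> {2j-1, 2j}\<close>; and \<open>{\<xi>\<^sub>t, \<xi>\<^sub>J}\<close> involves only those \<open>a\<^sub>i\<close> for which
  \<open>{t}\<close>, \<open>J\<close>, \<open>{2i-1, 2i}\<close> are disjoint. As \<open>I\<close> and \<open>J\<close> are disjoint, a nonzero term forces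
  \<open>J \<subseteq> {2j-1, 2j}\<close> and \<open>i \<noteq> j\<close>, hence \<open>n - 1 \<le> 2\<close> and \<open>a\<^sub>i a\<^sub>j \<noteq> 0\<close>. So the identity holds term by
  term for \<open>m \<ge> 7\<close>, or if at most one \<open>a\<^sub>j\<close> is nonzero. Conversely, for \<open>m = 5\<close> a single
  term survives on \<open>(\<xi>\<^sub>1, \<xi>\<^sub>3, \<xi>\<^sub>4)\<close>, and for \<open>m = 6\<close> two equal terms survive on
  \<open>(\<xi>\<^sub>1, \<xi>\<^sub>2, \<xi>\<^sub>3, \<xi>\<^sub>4, \<xi>\<^sub>6)\<close>.
\<close>

section \<open>Alternating functions and shuffles\<close>

text \<open>Polarization: with \<open>b p + b q\<close> in both slots \<open>p\<close> and
  \<open>q\<close>, the value and the two diagonal terms vanish, so the two mixed terms cancel.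
  Slots outside \<open>S\<close> are parameters, which allows \<open>F\<close> to alternate in one
  block of arguments only.\<close>

lemma alternating_swap:
  fixes F :: "('i \<Rightarrow> 'v::real_vector) \<Rightarrow> 'w::real_vector"
  assumes lin: "\<And>b i. i \<in> S \<Longrightarrow> linear (\<lambda>x. F (b(i := x)))"
    and alt: "\<And>b p q. p \<in> S \<Longrightarrow> q \<in> S \<Longrightarrow> p \<noteq> q \<Longrightarrow> b p = b q \<Longrightarrow> F b = 0"
    and pq: "p \<in> S" "q \<in> S" "p \<noteq> q"
  shows "F (b \<circ> Transposition.transpose p q) = - F b"
proof -
  define h where "h x y = F (b(p := x, q := y))" for x y
  have add_right: "h x (y + z) = h x y + h x z" for x y z
    unfolding h_def using linear_add[OF lin[OF pq(2)]] .
  have "h x y = F (b(q := y, p := x))" for x y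
    unfolding h_def using pq(3) by (simp add: fun_upd_twist)
  then have add_left: "h (x + y) z = h x z + h y z" for x y z
    using linear_add[OF lin[OF pq(1)]] by simp
  have diag: "h x x = 0" for x
    unfolding h_def by (rule alt[OF pq]) (use pq in auto)
  have "h (b p + b q) (b p + b q) = h (b p) (b q) + h (b q) (b p)"
    unfolding add_left[of "b p"] add_right[of _ "b p"] by (simp add: diag)
  moreover have "b(p := b q, q := b p) = b \<circ> Transposition.transpose p q"
    using pq by (auto simp: fun_eq_iff Transposition.transpose_def)
  ultimately show ?thesis
    by (simp add: diag h_def eq_neg_iff_add_eq_0 add.commute)
qed

text \<open>A permutation of \<open>S\<close> is built up by transpositions composed on the right,
  and each of them swaps two arguments of the family \<open>b \<circ> \<rho>\<close> reached so
  far.\<close>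

lemma alternating_permutes:
  fixes F :: "('i \<Rightarrow> 'v::real_vector) \<Rightarrow> 'w::real_vector"
  assumes lin: "\<And>b i. i \<in> S \<Longrightarrow> linear (\<lambda>x. F (b(i := x)))"
    and alt: "\<And>b p q. p \<in> S \<Longrightarrow> q \<in> S \<Longrightarrow> p \<noteq> q \<Longrightarrow> b p = b q \<Longrightarrow> F b = 0"
    and "finite S" "\<rho> permutes S"
  shows "F (b \<circ> \<rho>) = of_int (sign \<rho>) *\<^sub>R F b"
  using assms(3,4)
proof (induction rule: permutes_rev_induct)
  case (swap p q \<rho>)
  have "permutation \<rho>" using swap \<open>finite S\<close> by (auto simp: permutation_permutes)
  then have "sign (\<rho> \<circ> Transposition.transpose p q) = - sign \<rho>"
    using swap by (simp add: sign_compose sign_swap_id permutation_swap_id)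
  moreover have "F ((b \<circ> \<rho>) \<circ> Transposition.transpose p q) = - F (b \<circ> \<rho>)"
    by (rule alternating_swap[where S = S]) (fact lin alt swap)+
  ultimately show ?case unfolding swap.IH by (simp only: o_assoc of_int_minus scaleR_minus_left)
qed simp

lemma multilinear_zero_on_spanning:
  fixes F :: "('i \<Rightarrow> 'v::real_vector) \<Rightarrow> 'w::real_vector"
  assumes lin: "\<And>b i. i \<in> S \<Longrightarrow> linear (\<lambda>x. F (b(i := x)))"
    and zero: "\<And>b. (\<And>i. i \<in> S \<Longrightarrow> b i \<in> B) \<Longrightarrow> F b = 0"
    and "span B = UNIV" "finite S"
  shows "F b = 0"
proof -
  \<comment> \<open>\<open>S'\<close> collects the slots already freed from the restriction to
    \<open>B\<close>. Freeing one more slot uses that a linear map vanishing on \<open>B\<close>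
    vanishes on its span.\<close>
  have "F b = 0" if "S' \<subseteq> S" "\<And>i. i \<in> S - S' \<Longrightarrow> b i \<in> B" for S' b
    using finite_subset[OF that(1) \<open>finite S\<close>] that
  proof (induction S' arbitrary: b rule: finite_induct)
    case empty
    then show ?case using zero by auto
  next
    case (insert i S')
    have "F (b(i := x)) = 0" if "x \<in> B" for x
      by (rule insert.IH) (use insert.prems that in auto)
    then have "F (b(i := b i)) = 0"
      using linear_eq_0_on_span[OF lin, of i B b] insert.prems \<open>span B = UNIV\<close> by blast
    then show ?case by simp
  qed
  from this[of S] show ?thesis by simp
qed

section \<open>Shuffles as subsets of size \<open>n\<close>\<close>

text \<open>Both value lists are the increasing enumeration of the same finite set, and such an
  enumeration is unique.\<close>

lemma strict_mono_on_image_eq: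
  fixes f g :: "nat \<Rightarrow> nat"
  assumes f: "strict_mono_on {a..<c} f" and g: "strict_mono_on {a..<c} g"
    and eq: "f ` {a..<c} = g ` {a..<c}" and "i \<in> {a..<c}"
  shows "f i = g i"
proof -
  have "sorted_wrt (<) (map h [a..<c])" if "strict_mono_on {a..<c} h" for h :: "nat \<Rightarrow> nat"
    by (rule sorted_wrt_map_mono[OF sorted_wrt_upt]) (use that in \<open>auto simp: strict_mono_on_def\<close>)
  then have "map f [a..<c] = map g [a..<c]"
    using f g eq by (intro sorted_distinct_set_unique) (auto simp: strict_sorted_iff)
  then show ?thesis using assms(4) by simp
qed

text \<open>The set underlying \<open>I\<close> determines the pair \<open>(I, J)\<close>: the set
  underlying \<open>J\<close> is the complement, and each of the two is listed in increasing
  order.\<close>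

lemma jacobi_perms_bij_betw:
  "bij_betw (\<lambda>\<sigma>. \<sigma> ` {1..n}) (jacobi_perms n) {A. A \<subseteq> {1..2 * n - 1} \<and> card A = n}"
proof (cases "n = 0")
  case True
  then show ?thesis
    by (auto simp: bij_betw_def jacobi_perms_def inj_on_def dest: finite_subset)
next
  case False
  let ?N = "{1..2 * n - 1}" and ?J = "{n + 1..2 * n - 1}"
  have N: "?N = {1..n} \<union> ?J" and disj: "{1..n} \<inter> ?J = {}" using False by auto
  show ?thesis
  proof (rule bij_betwI')
    fix \<sigma> \<tau>
    assume \<sigma>: "\<sigma> \<in> jacobi_perms n" and \<tau>: "\<tau> \<in> jacobi_perms n"
    show "(\<sigma> ` {1..n} = \<tau> ` {1..n}) = (\<sigma> = \<tau>)"
    proof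
      assume eq: "\<sigma> ` {1..n} = \<tau> ` {1..n}"
      have J: "\<pi> ` ?J = ?N - \<pi> ` {1..n}" if "\<pi> \<in> jacobi_perms n" for \<pi>
      proof -
        have \<pi>: "\<pi> permutes ?N" using that by (simp add: jacobi_perms_def)
        then have "\<pi> ` ?N - \<pi> ` {1..n} = \<pi> ` (?N - {1..n})"
          by (simp add: image_set_diff permutes_inj)
        moreover have "?N - {1..n} = ?J" by auto
        ultimately show ?thesis using permutes_image[OF \<pi>] by simp
      qed
      have "\<sigma> i = \<tau> i" for i
      proof (cases "i \<in> ?N")
        case True
        then have "i \<in> {1..<Suc n} \<or> i \<in> {n + 1..<2 * n}"
          unfolding atLeastAtMost_iff atLeastLessThan_iff by linarith
        then consider "i \<in> {1..<Suc n}" | "i \<in> {n + 1..<2 * n}" by blast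
        then show ?thesis
        proof cases
          case 1
          then show ?thesis
            using strict_mono_on_image_eq[of 1 "Suc n" \<sigma> \<tau> i] \<sigma> \<tau> eq
            by (simp add: jacobi_perms_def atLeastLessThanSuc_atLeastAtMost)
        next
          case 2
          have *: "{n + 1..<2 * n} = ?J" using False by auto
          show ?thesis
            by (rule strict_mono_on_image_eq[OF _ _ _ 2], unfold *)
               (use \<sigma> \<tau> eq J[OF \<sigma>] J[OF \<tau>] in \<open>simp_all add: jacobi_perms_def\<close>)
        qed
      next
        case False
        then show ?thesis using \<sigma> \<tau> unfolding jacobi_perms_def by (metis (lifting) mem_Collect_eq permutes_not_in)
      qed
      then show "\<sigma> = \<tau>" by blast
    qed simp
  next
    fix \<sigma>
    assume "\<sigma> \<in> jacobi_perms n"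
    then have \<sigma>: "\<sigma> permutes ?N" by (simp add: jacobi_perms_def)
    then have "\<sigma> ` {1..n} \<subseteq> ?N" using permutes_image[OF \<sigma>] N by blast
    moreover have "card (\<sigma> ` {1..n}) = n"
      using permutes_inj[OF \<sigma>] by (simp add: card_image inj_on_subset)
    ultimately show "\<sigma> ` {1..n} \<in> {A. A \<subseteq> ?N \<and> card A = n}" by simp
  next
    fix A
    assume A: "A \<in> {A. A \<subseteq> ?N \<and> card A = n}"
    then have fin: "finite A" "finite (?N - A)" by (auto dest: finite_subset)
    have cd: "card A = n" "card (?N - A) = n - 1"
      using A by (auto simp: card_Diff_subset[OF fin(1)])
    obtain f where f: "bij_betw f {..<n} A" "strict_mono_on {..<n} f"
      using ex_bij_betw_strict_mono_card[OF fin(1)] cd by metis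
    obtain g where g: "bij_betw g {..<n - 1} (?N - A)" "strict_mono_on {..<n - 1} g"
      using ex_bij_betw_strict_mono_card[OF fin(2)] cd by metis
    \<comment> \<open>The increasing enumerations \<open>f\<close> of \<open>A\<close> and
      \<open>g\<close> of its complement start at index 0, while the two blocks of positions start
      at 1 and at \<open>n + 1\<close>; hence the shifts.\<close>
    define \<sigma> where "\<sigma> i = (if i \<in> {1..n} then f (i - 1) else if i \<in> ?J then g (i - n - 1) else i)" for i
    have "bij_betw (\<lambda>i. i - 1) {1..n} {..<n}"
      by (rule bij_betw_byWitness[of _ Suc]) auto
    from bij_betw_trans[OF this f(1)] have 1: "bij_betw \<sigma> {1..n} A"
      by (rule bij_betw_cong[THEN iffD1, rotated]) (simp add: \<sigma>_def)
    have "bij_betw (\<lambda>i. i - n - 1) ?J {..<n - 1}"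
      by (rule bij_betw_byWitness[of _ "\<lambda>i. i + n + 1"]) auto
    from bij_betw_trans[OF this g(1)] have 2: "bij_betw \<sigma> ?J (?N - A)"
      by (rule bij_betw_cong[THEN iffD1, rotated]) (auto simp: \<sigma>_def)
    have "bij_betw \<sigma> ?N ?N"
      using bij_betw_combine[OF 1 2] A N by (simp add: Un_absorb1)
    then have "\<sigma> permutes ?N"
      by (rule bij_imp_permutes) (auto simp: \<sigma>_def)
    moreover have "strict_mono_on {1..n} \<sigma>"
      by (rule strict_mono_onI) (auto simp: \<sigma>_def intro!: strict_mono_onD[OF f(2)])
    moreover have "strict_mono_on ?J \<sigma>"
      by (rule strict_mono_onI) (auto simp: \<sigma>_def intro!: strict_mono_onD[OF g(2)])
    ultimately have "\<sigma> \<in> jacobi_perms n" by (simp add: jacobi_perms_def)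
    moreover have "A = \<sigma> ` {1..n}" using 1 by (simp add: bij_betw_def)
    ultimately show "\<exists>\<sigma>\<in>jacobi_perms n. A = \<sigma> ` {1..n}" by blast
  qed
qed

text \<open>
  The monotone representatives of the \<open>n\<close>-subsets may be replaced by arbitrary ones, so that a
  transposition can act on the sum.
\<close>

lemma sum_jacobi_perms:
  assumes cong: "\<And>\<sigma> \<tau>. \<sigma> permutes {1..2 * n - 1} \<Longrightarrow> \<tau> permutes {1..2 * n - 1} \<Longrightarrow>
      \<sigma> ` {1..n} = \<tau> ` {1..n} \<Longrightarrow> h \<sigma> = h \<tau>"
    and s: "\<And>A. A \<subseteq> {1..2 * n - 1} \<Longrightarrow> card A = n \<Longrightarrow> s A permutes {1..2 * n - 1} \<and> s A ` {1..n} = A"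
  shows "(\<Sum>\<sigma>\<in>jacobi_perms n. h \<sigma>) = (\<Sum>A | A \<subseteq> {1..2 * n - 1} \<and> card A = n. h (s A))"
proof -
  have "h \<sigma> = h (s (\<sigma> ` {1..n}))" if "\<sigma> \<in> jacobi_perms n" for \<sigma>
  proof -
    have "\<sigma> ` {1..n} \<in> {A. A \<subseteq> {1..2 * n - 1} \<and> card A = n}"
      using bij_betw_apply[OF jacobi_perms_bij_betw that] .
    then show ?thesis
      using cong[of \<sigma> "s (\<sigma> ` {1..n})"] s that by (simp add: jacobi_perms_def)
  qed
  then have "(\<Sum>\<sigma>\<in>jacobi_perms n. h \<sigma>) = (\<Sum>\<sigma>\<in>jacobi_perms n. h (s (\<sigma> ` {1..n})))"
    by (rule sum.cong[OF refl])
  also have "\<dots> = (\<Sum>A | A \<subseteq> {1..2 * n - 1} \<and> card A = n. h (s A))"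
    by (rule sum.reindex_bij_betw[OF jacobi_perms_bij_betw])
  finally show ?thesis .
qed

section \<open>Antisymmetrization of maps that alternate in two blocks\<close>

text \<open>Abstracts the product \<open>{{b_1, ..., b_n}, b_(n+1), ..., b_(2n-1)}\<close>, which
  alternates within the inner and within the outer arguments, but not across the two blocks.
  Families are total functions on \<open>nat\<close>, so \<open>T_cong\<close> records that only the
  first \<open>2 * n - 1\<close> positions count.\<close>

locale block_alternating =
  fixes T :: "(nat \<Rightarrow> 'v::real_vector) \<Rightarrow> 'w::real_vector" and n :: nat
  assumes T_cong: "(\<And>i. i \<in> {1..2 * n - 1} \<Longrightarrow> b i = b' i) \<Longrightarrow> T b = T b'"
    and T_linear: "i \<in> {1..2 * n - 1} \<Longrightarrow> linear (\<lambda>x. T (b(i := x)))"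
    and T_left: "p \<in> {1..n} \<Longrightarrow> q \<in> {1..n} \<Longrightarrow> p \<noteq> q \<Longrightarrow> b p = b q \<Longrightarrow> T b = 0"
    and T_right: "p \<in> {n + 1..2 * n - 1} \<Longrightarrow> q \<in> {n + 1..2 * n - 1} \<Longrightarrow> p \<noteq> q \<Longrightarrow> b p = b q \<Longrightarrow> T b = 0"
begin

definition signed :: "(nat \<Rightarrow> 'v) \<Rightarrow> (nat \<Rightarrow> nat) \<Rightarrow> 'w" where
  "signed b \<sigma> = of_int (sign \<sigma>) *\<^sub>R T (b \<circ> \<sigma>)"

definition shuffle_sum :: "(nat \<Rightarrow> 'v) \<Rightarrow> 'w" where
  "shuffle_sum b = (\<Sum>\<sigma>\<in>jacobi_perms n. signed b \<sigma>)"

text \<open>The two permutations differ by a right factor \<open>\<rho>\<close> that preserves both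
  blocks. Alternation within the blocks gives the factor \<open>sign \<rho>\<close>, which cancels
  the one arising from the sign of \<open>\<tau>\<close>.\<close>

lemma signed_cong:
  assumes \<sigma>: "\<sigma> permutes {1..2 * n - 1}" and \<tau>: "\<tau> permutes {1..2 * n - 1}"
    and eq: "\<sigma> ` {1..n} = \<tau> ` {1..n}"
  shows "signed b \<sigma> = signed b \<tau>"
proof -
  let ?N = "{1..2 * n - 1}" and ?J = "{n + 1..2 * n - 1}"
  define \<rho> where "\<rho> = inv \<sigma> \<circ> \<tau>"
  have \<rho>: "\<rho> permutes ?N" unfolding \<rho>_def by (intro permutes_compose permutes_inv \<sigma> \<tau>)
  have \<tau>_eq: "\<tau> = \<sigma> \<circ> \<rho>" using permutes_inverses(1)[OF \<sigma>] by (simp add: \<rho>_def fun_eq_iff)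
  have "\<rho> ` {1..n} = inv \<sigma> ` \<sigma> ` {1..n}" unfolding \<rho>_def eq by (simp add: image_comp)
  also have "\<dots> = {1..n}" using permutes_inverses(2)[OF \<sigma>] by (simp add: image_image)
  finally have \<rho>n: "\<rho> ` {1..n} = {1..n}" .
  \<comment> \<open>The factor \<open>\<rho>\<close> is split into its actions
    \<open>\<alpha>\<close> on the first block and \<open>\<beta>\<close> on the second, so that
    each can be absorbed by alternation in its own block.\<close>
  define \<alpha> where "\<alpha> i = (if i \<in> {1..n} then \<rho> i else i)" for i
  define \<beta> where "\<beta> i = (if i \<in> {1..n} then i else \<rho> i)" for i
  have inj: "inj \<rho>" using permutes_inj[OF \<rho>] .
  have notin: "\<rho> i \<notin> {1..n}" if "i \<notin> {1..n}" for i
    using that inj_image_mem_iff[OF inj, of i "{1..n}"] unfolding \<rho>n by blast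
  have \<alpha>: "\<alpha> permutes {1..n}"
  proof (rule bij_imp_permutes)
    show "bij_betw \<alpha> {1..n} {1..n}"
      by (rule bij_betw_cong[THEN iffD1, OF _ inj_on_imp_bij_betw[OF inj_on_subset[OF inj], of "{1..n}", unfolded \<rho>n]])
         (simp_all add: \<alpha>_def)
  qed (auto simp: \<alpha>_def)
  have \<beta>: "\<beta> permutes ?J"
  proof (rule bij_imp_permutes)
    have *: "?N - {1..n} = ?J" by auto
    have "\<rho> ` (?N - {1..n}) = ?N - {1..n}"
      unfolding image_set_diff[OF inj] \<rho>n permutes_image[OF \<rho>] ..
    then have "\<rho> ` ?J = ?J" unfolding * .
    then have "bij_betw \<rho> ?J ?J" using inj_on_subset[OF inj] by (simp add: bij_betw_def)
    then show "bij_betw \<beta> ?J ?J"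
      by (rule bij_betw_cong[THEN iffD1, rotated]) (auto simp: \<beta>_def)
    fix i assume "i \<notin> ?J"
    then show "\<beta> i = i" using permutes_not_in[OF \<rho>, of i] by (auto simp: \<beta>_def)
  qed
  have \<rho>_eq: "\<rho> = \<alpha> \<circ> \<beta>" using notin by (auto simp: \<alpha>_def \<beta>_def fun_eq_iff)
  have perm: "permutation \<sigma>" "permutation \<rho>" "permutation \<alpha>" "permutation \<beta>"
    using \<sigma> \<rho> \<alpha> \<beta> by (auto simp: permutation_permutes)
  have lin_left: "linear (\<lambda>x. T (c(i := x)))" if "i \<in> {1..n}" for c i
    by (rule T_linear) (use that in auto)
  have lin_right: "linear (\<lambda>x. T (c(i := x)))" if "i \<in> ?J" for c i
    by (rule T_linear) (use that in auto)
  have "T (b \<circ> \<tau>) = T ((b \<circ> \<sigma> \<circ> \<alpha>) \<circ> \<beta>)" by (simp add: \<tau>_eq \<rho>_eq comp_assoc)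
  also have "\<dots> = of_int (sign \<beta>) *\<^sub>R T (b \<circ> \<sigma> \<circ> \<alpha>)"
    by (rule alternating_permutes[OF lin_right _ _ \<beta>]) (rule T_right finite_atLeastAtMost | assumption)+
  also have "T (b \<circ> \<sigma> \<circ> \<alpha>) = of_int (sign \<alpha>) *\<^sub>R T (b \<circ> \<sigma>)"
    by (rule alternating_permutes[OF lin_left _ _ \<alpha>]) (rule T_left finite_atLeastAtMost | assumption)+
  finally have "T (b \<circ> \<tau>) = of_int (sign \<rho>) *\<^sub>R T (b \<circ> \<sigma>)"
    by (simp only: \<rho>_eq sign_compose[OF perm(3,4)] scaleR_scaleR of_int_mult mult.commute)
  moreover have "of_int (sign \<rho>) * of_int (sign \<rho>) = (1::real)"
    by (simp flip: of_int_mult)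
  ultimately show ?thesis
    using perm by (simp add: signed_def \<tau>_eq sign_compose mult.assoc)
qed

text \<open>The shuffles themselves serve as representatives of the subsets.\<close>

lemma ex_section:
  "\<exists>s. \<forall>A. A \<subseteq> {1..2 * n - 1} \<longrightarrow> card A = n \<longrightarrow> s A permutes {1..2 * n - 1} \<and> s A ` {1..n} = A"
proof (intro exI allI impI)
  fix A :: "nat set"
  let ?s = "inv_into (jacobi_perms n) (\<lambda>\<sigma>. \<sigma> ` {1..n})"
  assume "A \<subseteq> {1..2 * n - 1}" "card A = n"
  then have A: "A \<in> (\<lambda>\<sigma>. \<sigma> ` {1..n}) ` jacobi_perms n"
    using jacobi_perms_bij_betw[of n] by (simp add: bij_betw_def)
  show "?s A permutes {1..2 * n - 1} \<and> ?s A ` {1..n} = A"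
    using inv_into_into[OF A] f_inv_into_f[OF A] by (simp add: jacobi_perms_def)
qed

text \<open>Meant for explicit evaluation: only the subsets in \<open>\<A>\<close> can contribute,
  and each is evaluated at any convenient representative \<open>p A\<close>, which need not be
  monotone on the blocks.\<close>

lemma shuffle_sum_support:
  assumes "\<A> \<subseteq> {A. A \<subseteq> {1..2 * n - 1} \<and> card A = n}"
    and zero: "\<And>\<sigma>. \<sigma> permutes {1..2 * n - 1} \<Longrightarrow> card (\<sigma> ` {1..n}) = n \<Longrightarrow> \<sigma> ` {1..n} \<notin> \<A> \<Longrightarrow> signed b \<sigma> = 0"
    and p: "\<And>A. A \<in> \<A> \<Longrightarrow> p A permutes {1..2 * n - 1} \<and> p A ` {1..n} = A"
  shows "shuffle_sum b = (\<Sum>A\<in>\<A>. signed b (p A))"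
proof -
  let ?N = "{1..2 * n - 1}"
  from ex_section obtain s
    where s: "\<forall>A. A \<subseteq> ?N \<longrightarrow> card A = n \<longrightarrow> s A permutes ?N \<and> s A ` {1..n} = A" ..
  have "shuffle_sum b = (\<Sum>A | A \<subseteq> ?N \<and> card A = n. signed b (s A))"
    unfolding shuffle_sum_def by (rule sum_jacobi_perms[OF signed_cong]) (use s in blast)+
  also have "\<dots> = (\<Sum>A\<in>\<A>. signed b (s A))"
  proof (rule sum.mono_neutral_right)
    show "\<forall>A\<in>{A. A \<subseteq> ?N \<and> card A = n} - \<A>. signed b (s A) = 0"
      using s by (auto intro!: zero)
  qed (use assms(1) in auto)
  also have "\<dots> = (\<Sum>A\<in>\<A>. signed b (p A))"
  proof (rule sum.cong[OF refl])
    fix A assume A: "A \<in> \<A>"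
    with assms(1) s have "s A permutes ?N" "s A ` {1..n} = A" by blast+
    with p[OF A] show "signed b (s A) = signed b (p A)" by (intro signed_cong) simp_all
  qed
  finally show ?thesis .
qed

text \<open>The transposition of \<open>p\<close> and \<open>q\<close> leaves \<open>b\<close>
  unchanged and permutes the subsets of size \<open>n\<close>. Composing it with a representative of
  \<open>A\<close> gives a representative of the transposed subset with opposite sign, so the sum
  equals its own negative.\<close>

lemma shuffle_sum_alternating:
  assumes pq: "p \<in> {1..2 * n - 1}" "q \<in> {1..2 * n - 1}" "p \<noteq> q" and b: "b p = b q"
  shows "shuffle_sum b = 0"
proof -
  let ?N = "{1..2 * n - 1}" and ?\<A> = "{A. A \<subseteq> {1..2 * n - 1} \<and> card A = n}" and ?\<tau> = "Transposition.transpose p q"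
  from ex_section obtain s
    where s: "\<forall>A. A \<subseteq> ?N \<longrightarrow> card A = n \<longrightarrow> s A permutes ?N \<and> s A ` {1..n} = A" ..
  have \<tau>: "?\<tau> permutes ?N" by (rule permutes_swap_id[OF pq(1,2)])
  have b\<tau>: "b \<circ> ?\<tau> = b" using b by (auto simp: fun_eq_iff Transposition.transpose_def)
  have sum: "shuffle_sum b = (\<Sum>A\<in>?\<A>. signed b (s A))"
    unfolding shuffle_sum_def by (rule sum_jacobi_perms[OF signed_cong]) (use s in blast)+
  have \<tau>_in: "?\<tau> ` A \<in> ?\<A>" if "A \<in> ?\<A>" for A
  proof -
    have "?\<tau> ` A \<subseteq> ?N" using that permutes_image[OF \<tau>] by blast
    moreover have "card (?\<tau> ` A) = n"
      using that card_image[OF inj_on_subset[OF permutes_inj[OF \<tau>]], of A] by simp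
    ultimately show ?thesis by blast
  qed
  have "?\<tau> ` ?\<tau> ` A = A" for A by (simp only: image_comp transpose_comp_involutory image_id id_apply)
  then have "bij_betw ((`) ?\<tau>) ?\<A> ?\<A>"
    by (intro bij_betw_byWitness[of _ "(`) ?\<tau>"] ballI image_subsetI \<tau>_in)
  from sum.reindex_bij_betw[OF this, of "\<lambda>A. signed b (s A)"]
  have "shuffle_sum b = (\<Sum>A\<in>?\<A>. signed b (s (?\<tau> ` A)))" unfolding sum ..
  also have "\<dots> = (\<Sum>A\<in>?\<A>. - signed b (s A))"
  proof (rule sum.cong[OF refl])
    fix A assume A: "A \<in> ?\<A>"
    have sA: "s A permutes ?N" "s A ` {1..n} = A" using s A by auto
    have "signed b (s (?\<tau> ` A)) = signed b (?\<tau> \<circ> s A)"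
    proof (rule signed_cong)
      show "s (?\<tau> ` A) permutes ?N" using s \<tau>_in[OF A] by blast
      show "?\<tau> \<circ> s A permutes ?N" using permutes_compose[OF sA(1) \<tau>] .
      have "s (?\<tau> ` A) ` {1..n} = ?\<tau> ` A" using s \<tau>_in[OF A] by blast
      then show "s (?\<tau> ` A) ` {1..n} = (?\<tau> \<circ> s A) ` {1..n}"
        by (simp only: image_comp[symmetric] sA(2))
    qed
    also have "\<dots> = - signed b (s A)"
    proof -
      have "permutation (s A)" using sA by (auto simp: permutation_permutes)
      then show ?thesis
        using pq by (simp add: signed_def b\<tau> o_assoc sign_compose permutation_swap_id sign_swap_id)
    qed
    finally show "signed b (s (?\<tau> ` A)) = - signed b (s A)" .
  qed
  also have "\<dots> = - shuffle_sum b" by (simp add: sum sum_negf)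
  finally have "2 *\<^sub>R shuffle_sum b = 0" unfolding scaleR_2 eq_neg_iff_add_eq_0 .
  then show ?thesis by simp
qed

lemma linear_shuffle_sum:
  assumes "i \<in> {1..2 * n - 1}"
  shows "linear (\<lambda>x. shuffle_sum (b(i := x)))"
  unfolding shuffle_sum_def signed_def
proof (intro linear_compose_sum ballI linear_compose_scale_right)
  fix \<sigma> assume "\<sigma> \<in> jacobi_perms n"
  then have \<sigma>: "\<sigma> permutes {1..2 * n - 1}" by (simp add: jacobi_perms_def)
  \<comment> \<open>In the term of \<open>\<sigma>\<close> the vector \<open>b i\<close> is consumed
    at position \<open>inv \<sigma> i\<close>, so linearity of \<open>T\<close> in that position
    applies.\<close>
  have "b(i := x) \<circ> \<sigma> = (b \<circ> \<sigma>)(inv \<sigma> i := x)" for x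
    using permutes_inverses[OF \<sigma>] by (auto simp: fun_eq_iff)
  moreover have "inv \<sigma> i \<in> {1..2 * n - 1}"
    using permutes_in_image[OF permutes_inv[OF \<sigma>]] assms by blast
  ultimately show "linear (\<lambda>x. T (b(i := x) \<circ> \<sigma>))"
    using T_linear by simp
qed

text \<open>By multilinearity only families of basis vectors matter. A repeated index is handled by
  alternation of the whole sum; for distinct indices every single term is required to
  vanish.\<close>

lemma shuffle_sum_eq_0:
  assumes span: "span (\<xi> ` M) = UNIV"
    and zero: "\<And>c. c ` {1..2 * n - 1} \<subseteq> M \<Longrightarrow> inj_on c {1..2 * n - 1} \<Longrightarrow> T (\<xi> \<circ> c) = 0"
  shows "shuffle_sum b = 0"
proof (rule multilinear_zero_on_spanning[where S = "{1..2 * n - 1}" and B = "\<xi> ` M"])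
  fix b assume "\<And>i. i \<in> {1..2 * n - 1} \<Longrightarrow> b i \<in> \<xi> ` M"
  then have "\<forall>i\<in>{1..2 * n - 1}. \<exists>j\<in>M. b i = \<xi> j" by blast
  then obtain c where c: "\<And>i. i \<in> {1..2 * n - 1} \<Longrightarrow> c i \<in> M \<and> b i = \<xi> (c i)" by metis
  show "shuffle_sum b = 0"
  proof (cases "inj_on c {1..2 * n - 1}")
    case False
    then obtain p q where pq: "p \<in> {1..2 * n - 1}" "q \<in> {1..2 * n - 1}" "p \<noteq> q" and "c p = c q"
      unfolding inj_on_def by blast
    then show ?thesis using c[OF pq(1)] c[OF pq(2)] by (intro shuffle_sum_alternating[OF pq]) simp
  next
    case True
    have "T (b \<circ> \<sigma>) = 0" if "\<sigma> \<in> jacobi_perms n" for \<sigma>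
    proof -
      have \<sigma>: "\<sigma> permutes {1..2 * n - 1}" using that by (simp add: jacobi_perms_def)
      have "T (\<xi> \<circ> (c \<circ> \<sigma>)) = 0"
      proof (rule zero)
        show "(c \<circ> \<sigma>) ` {1..2 * n - 1} \<subseteq> M"
          using c permutes_in_image[OF \<sigma>] by auto
        show "inj_on (c \<circ> \<sigma>) {1..2 * n - 1}"
          by (rule comp_inj_on) (use True \<sigma> permutes_image[OF \<sigma>] in \<open>auto intro: permutes_inj_on\<close>)
      qed
      moreover have "T (b \<circ> \<sigma>) = T (\<xi> \<circ> (c \<circ> \<sigma>))"
        by (rule T_cong) (use c permutes_in_image[OF \<sigma>] in auto)
      ultimately show ?thesis by simp
    qed
    then show ?thesis by (simp add: shuffle_sum_def signed_def)
  qed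
qed (rule linear_shuffle_sum span finite_atLeastAtMost | assumption)+

end

section \<open>Iterated contractions\<close>

abbreviation contract :: "'v::euclidean_space list \<Rightarrow> 'v ext \<Rightarrow> 'v ext" where
  "contract \<equiv> foldr con"

lemma brackets_map_iota: "brackets (map \<iota> xs) w = contract xs w"
  by (induction xs) (simp_all add: brackets_def poisson_iota_left)

text \<open>Polarization of the fact that contracting twice with the same vector gives 0.\<close>

lemma con_anticomm: "con x (con y w) = - con y (con x w)"
proof -
  have "0 = con (x + y) (con (x + y) w)" by simp
  also have "\<dots> = con x (con y w) + con y (con x w)"
    by (simp only: con_add_left con_add con_con) simp
  finally show ?thesis by (simp add: eq_neg_iff_add_eq_0)
qed

lemma linear_con_left: "linear (\<lambda>x. con x w)"
  by (rule linearI) (simp_all add: con_add_left con_scaleR_left)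

lemma linear_contract: "linear (contract xs)"
  by (rule linearI; induction xs) (simp_all add: con_add con_scaleR)

lemma con_contract_mem: "x \<in> set xs \<Longrightarrow> con x (contract xs w) = 0"
proof (induction xs)
  case (Cons y ys)
  then show ?case
    by (cases "x = y") (simp_all add: con_anticomm[of x y] con_linear_simps)
qed simp

lemma contract_not_distinct: "\<not> distinct xs \<Longrightarrow> contract xs w = 0"
  by (induction xs) (auto simp: con_contract_mem con_linear_simps)

text \<open>As \<open>ks\<close> is distinct, the entry with index \<open>i\<close> is used in
  exactly one contraction.\<close>

lemma contract_linear_slot:
  assumes "distinct ks" "i \<in> set ks"
  shows "linear (\<lambda>x. contract (map (b(i := x)) ks) w)"
  using assms
proof (induction ks)
  case (Cons j js)
  show ?case
  proof (cases "i = j")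
    case True
    then have eq: "map (b(j := x)) js = map b js" for x using Cons.prems by simp
    show ?thesis
      unfolding True list.map foldr.simps comp_apply eq fun_upd_same by (rule linear_con_left)
  next
    case False
    then have "linear (\<lambda>x. contract (map (b(i := x)) js) w)"
      using Cons by (simp del: fun_upd_apply)
    from linear_compose[OF this linear_con] show ?thesis
      using False unfolding list.map foldr.simps comp_def by simp
  qed
qed simp

section \<open>The nested product as a block-alternating map\<close>

text \<open>The term of the Jacobi sum for the identity permutation. The inner product is an element
  of the exterior algebra rather than a vector, so the bracket with it stays a
  \<open>poisson\<close> bracket while all others become contractions.\<close>

definition nested_mult :: "nat \<Rightarrow> 'v::euclidean_space ext \<Rightarrow> (nat \<Rightarrow> 'v) \<Rightarrow> 'v ext" where
  "nested_mult n \<mu> b = poisson (contract (map b [1..<Suc n]) \<mu>) (contract (map b [Suc n..<2 * n]) \<mu>)"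

lemma nested_mult_eq:
  "derived_mult \<mu> (derived_mult \<mu> (map (\<lambda>r. \<iota> (b r)) [1..<Suc n]) # map (\<lambda>r. \<iota> (b r)) [Suc n..<2 * n]) =
   nested_mult n \<mu> b"
proof -
  have "brackets (map (\<lambda>r. \<iota> (b r)) ks) \<mu> = contract (map b ks) \<mu>" for ks
    using brackets_map_iota[of "map b ks" \<mu>] by (simp add: o_def)
  then show ?thesis by (simp add: derived_mult_def nested_mult_def brackets_def)
qed

lemma linear_poisson: "linear (poisson v)" "linear (\<lambda>v. poisson v w)"
  using poisson_bracket_bilinear[OF poisson_bracket_poisson] by (auto simp: bilinear_def)

lemma linear_nested_mult:
  assumes i: "i \<in> {1..2 * n - 1}"
  shows "linear (\<lambda>x. nested_mult n \<mu> (b(i := x)))"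
proof (cases "i \<in> {1..n}")
  case True
  then have "map (b(i := x)) [Suc n..<2 * n] = map b [Suc n..<2 * n]" for x
    unfolding map_eq_conv set_upt by auto
  moreover have "linear (\<lambda>x. contract (map (b(i := x)) [1..<Suc n]) \<mu>)"
    by (rule contract_linear_slot) (use True in auto)
  from linear_compose[OF this linear_poisson(2)]
  have "linear (\<lambda>x. poisson (contract (map (b(i := x)) [1..<Suc n]) \<mu>) (contract (map b [Suc n..<2 * n]) \<mu>))"
    by (simp only: o_def)
  ultimately show ?thesis by (simp only: nested_mult_def)
next
  case False
  then have "map (b(i := x)) [1..<Suc n] = map b [1..<Suc n]" for x
    unfolding map_eq_conv set_upt by auto
  moreover have "linear (\<lambda>x. contract (map (b(i := x)) [Suc n..<2 * n]) \<mu>)"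
    by (rule contract_linear_slot) (use i False in auto)
  from linear_compose[OF this linear_poisson(1)]
  have "linear (\<lambda>x. poisson (contract (map b [1..<Suc n]) \<mu>) (contract (map (b(i := x)) [Suc n..<2 * n]) \<mu>))"
    by (simp only: o_def)
  ultimately show ?thesis by (simp only: nested_mult_def)
qed

lemma block_alternating_nested_mult: "block_alternating (nested_mult n \<mu>) n"
proof (rule block_alternating.intro)
  fix b b' :: "nat \<Rightarrow> 'a"
  assume "\<And>i. i \<in> {1..2 * n - 1} \<Longrightarrow> b i = b' i"
  then have "map b [1..<Suc n] = map b' [1..<Suc n]" "map b [Suc n..<2 * n] = map b' [Suc n..<2 * n]"
    unfolding map_eq_conv set_upt by auto
  then show "nested_mult n \<mu> b = nested_mult n \<mu> b'" by (simp only: nested_mult_def)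
next
  show "linear (\<lambda>x. nested_mult n \<mu> (b(i := x)))" if "i \<in> {1..2 * n - 1}" for i and b :: "nat \<Rightarrow> 'a"
    using that by (rule linear_nested_mult)
next
  fix p q and b :: "nat \<Rightarrow> 'a"
  assume pq: "p \<in> {1..n}" "q \<in> {1..n}" "p \<noteq> q" "b p = b q"
  then have "p \<in> set [1..<Suc n]" "q \<in> set [1..<Suc n]" by auto
  with pq have "\<not> distinct (map b [1..<Suc n])" unfolding distinct_map inj_on_def by blast
  then show "nested_mult n \<mu> b = 0"
    unfolding nested_mult_def by (simp only: contract_not_distinct not_False_eq_True linear_0[OF linear_poisson(2)])
next
  fix p q and b :: "nat \<Rightarrow> 'a"
  assume pq: "p \<in> {n + 1..2 * n - 1}" "q \<in> {n + 1..2 * n - 1}" "p \<noteq> q" "b p = b q"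
  then have "p \<in> set [Suc n..<2 * n]" "q \<in> set [Suc n..<2 * n]" by auto
  with pq have "\<not> distinct (map b [Suc n..<2 * n])" unfolding distinct_map inj_on_def by blast
  then show "nested_mult n \<mu> b = 0"
    unfolding nested_mult_def by (simp only: contract_not_distinct not_False_eq_True linear_0[OF linear_poisson(1)])
qed

global_interpretation nested: block_alternating "nested_mult n \<mu>" n
  for n and \<mu> :: "'v::euclidean_space ext"
  by (rule block_alternating_nested_mult)

lemma jacobi_identity_iff: "jacobi_identity n \<mu> \<longleftrightarrow> (\<forall>b. nested.shuffle_sum n \<mu> b = 0)"
proof -
  have "of_int z * w = of_int z *\<^sub>R w" for z and w :: "'a ext"
    by (simp add: scaleR_conv_of_real)
  then show ?thesis
    unfolding jacobi_identity_def nested_mult_eq nested.shuffle_sum_def nested.signed_def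
    by (simp only: o_def)
qed

section \<open>Orthonormal bases\<close>

lemma orthonormal_basis_inner:
  "orthonormal_basis m \<xi> \<Longrightarrow> i \<in> {1..m} \<Longrightarrow> j \<in> {1..m} \<Longrightarrow> \<xi> i \<bullet> \<xi> j = (if i = j then 1 else 0)"
  by (simp add: orthonormal_basis_def)

text \<open>The difference of the two sides is orthogonal to every basis vector, hence to
  itself.\<close>

lemma orthonormal_basis_expand:
  assumes \<xi>: "orthonormal_basis m \<xi>" and t: "t \<in> {1..m}"
    and orth: "\<And>s. s \<in> {1..m} - {t} \<Longrightarrow> \<xi> s \<bullet> u = 0"
  shows "u = (\<xi> t \<bullet> u) *\<^sub>R \<xi> t"
proof -
  let ?d = "u - (\<xi> t \<bullet> u) *\<^sub>R \<xi> t"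
  have "\<xi> s \<bullet> ?d = 0" if "s \<in> {1..m}" for s
    using that t orth[of s] orthonormal_basis_inner[OF \<xi> that t] by (simp add: inner_diff_right)
  then have "y \<bullet> ?d = 0" if "y \<in> \<xi> ` {1..m}" for y
    using that by blast
  then have "orthogonal ?d y" if "y \<in> span (\<xi> ` {1..m})" for y
    by (intro orthogonal_to_span[OF that]) (simp add: orthogonal_def inner_commute)
  then have "orthogonal ?d ?d" using \<xi> by (simp add: orthonormal_basis_def)
  then show ?thesis by (simp add: orthogonal_self)
qed

lemma top_form_S: "top_form m \<xi> \<in> ext_pow m"
  using monomial_in_S[of "map \<xi> [1..<Suc m]"] unfolding top_form_def by (simp del: upt_Suc)

lemma star_two_vectors:
  "star L (\<Sum>j\<in>J. a j *\<^sub>R (\<iota> (x j) * \<iota> (y j))) = (\<Sum>j\<in>J. a j *\<^sub>R con (x j) (con (y j) L))"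
proof -
  have "star L (\<iota> (x j) * \<iota> (y j)) = con (x j) (con (y j) L)" for j
    using star_monomial[of L "[x j, y j]"] by (simp add: brackets_def poisson_iota_left)
  then show ?thesis by (simp add: linear_sum[OF linear_star] linear_scale[OF linear_star])
qed

text \<open>A nonzero contraction uses \<open>m - 1\<close> distinct basis vectors. The result lies
  in \<open>V\<close> and is orthogonal to all of them, so it is a multiple of the one left over.
  The coefficient \<open>r\<close> is left open, since only \<open>t\<close> matters for deciding
  which terms vanish.\<close>

lemma contract_basis_S1:
  assumes \<xi>: "orthonormal_basis m \<xi>" and L: "L \<in> ext_pow m"
    and xs: "set xs \<subseteq> {1..m}" "m = length xs + 1" and nz: "contract (map \<xi> xs) L \<noteq> 0"
  obtains r t where "t \<in> {1..m}" "set xs = {1..m} - {t}" "contract (map \<xi> xs) L = \<iota> (r *\<^sub>R \<xi> t)"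
proof -
  have "distinct xs"
    using nz contract_not_distinct[of "map \<xi> xs" L] by (auto simp: distinct_map)
  then have "card ({1..m} - set xs) = 1"
    using xs by (simp add: card_Diff_subset distinct_card)
  then obtain t where t: "{1..m} - set xs = {t}" by (auto simp: card_1_singleton_iff)
  then have set: "set xs = {1..m} - {t}" and t_in: "t \<in> {1..m}" using xs by auto
  have "brackets (map \<iota> (map \<xi> xs)) L \<in> ext_pow 1"
    by (rule brackets_iota_S) (use L xs in simp)
  then obtain u where u: "contract (map \<xi> xs) L = \<iota> u"
    unfolding brackets_map_iota S_1_eq by blast
  have "\<xi> s \<bullet> u = 0" if "s \<in> {1..m} - {t}" for s
  proof -
    have "con (\<xi> s) (\<iota> u) = 0"
      unfolding u[symmetric] by (rule con_contract_mem) (use that set in auto)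
    then show ?thesis by simp
  qed
  from orthonormal_basis_expand[OF \<xi> t_in this] show ?thesis
    using that[OF t_in set] u by metis
qed

section \<open>The Jacobi identity on basis vectors\<close>

text \<open>Here \<open>j\<close> comes from the inner copy of \<open>\<mu>\<close> and
  \<open>i\<close> from the outer one. The inner product leaves a multiple of
  \<open>\<xi> t\<close>, where \<open>t\<close> is the only index outside the first block and the
  pair of \<open>j\<close>; contracting the outer part with \<open>\<xi> t\<close> then requires
  \<open>t\<close>, the second block and the pair of \<open>i\<close> to be disjoint.\<close>

lemma nested_mult_basis_nonzero:
  assumes \<xi>: "orthonormal_basis m \<xi>" and L: "L \<in> ext_pow m" and m: "m = n + 3" "n \<noteq> 0" "2 * k \<le> m"
    and \<mu>: "\<mu> = (\<Sum>j = 1..k. a j *\<^sub>R con (\<xi> (2 * j - 1)) (con (\<xi> (2 * j)) L))"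
    and c: "inj_on c {1..2 * n - 1}" "c ` {1..2 * n - 1} \<subseteq> {1..m}"
    and nz: "nested_mult n \<mu> (\<xi> \<circ> c) \<noteq> 0"
  obtains i j where "i \<in> {1..k}" "j \<in> {1..k}" "a i \<noteq> 0" "a j \<noteq> 0"
    "c ` {1..n} \<inter> {2 * j - 1, 2 * j} = {}" "c ` {n + 1..2 * n - 1} \<subseteq> {2 * j - 1, 2 * j} - {2 * i - 1, 2 * i}"
proof -
  define D where "D j = contract (map \<xi> (map c [1..<Suc n] @ [2 * j - 1, 2 * j])) L" for j
  define E where "E i = contract (map \<xi> (map c [Suc n..<2 * n] @ [2 * i - 1, 2 * i])) L" for i
  \<comment> \<open>Each summand of \<open>\<mu>\<close> is itself a contraction of \<open>L\<close>
    by a pair, so contracting \<open>\<mu>\<close> only prolongs the list of contractions of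
    \<open>L\<close>.\<close>
  have expand: "contract xs \<mu> = (\<Sum>j = 1..k. a j *\<^sub>R contract (xs @ [\<xi> (2 * j - 1), \<xi> (2 * j)]) L)" for xs
    unfolding \<mu> by (simp add: linear_sum[OF linear_contract] linear_scale[OF linear_contract])
  have D: "contract (map (\<xi> \<circ> c) [1..<Suc n]) \<mu> = (\<Sum>j = 1..k. a j *\<^sub>R D j)"
    and E: "contract (map (\<xi> \<circ> c) [Suc n..<2 * n]) \<mu> = (\<Sum>i = 1..k. a i *\<^sub>R E i)"
    unfolding expand D_def E_def by (simp_all del: upt_Suc foldr_append)
  have "nested_mult n \<mu> (\<xi> \<circ> c) = (\<Sum>j = 1..k. \<Sum>i = 1..k. a j *\<^sub>R a i *\<^sub>R poisson (D j) (E i))"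
    unfolding nested_mult_def D E linear_sum[OF linear_poisson(2)] linear_scale[OF linear_poisson(2)]
    unfolding linear_sum[OF linear_poisson(1)] linear_scale[OF linear_poisson(1)] scaleR_right.sum ..
  with nz obtain j where j: "j \<in> {1..k}" and "(\<Sum>i = 1..k. a j *\<^sub>R a i *\<^sub>R poisson (D j) (E i)) \<noteq> 0"
    by (metis (no_types, lifting) sum.not_neutral_contains_not_neutral)
  then obtain i where i: "i \<in> {1..k}" and ij: "a j *\<^sub>R a i *\<^sub>R poisson (D j) (E i) \<noteq> 0"
    by (metis (no_types, lifting) sum.not_neutral_contains_not_neutral)
  have pair: "{2 * l - 1, 2 * l} \<subseteq> {1..m}" if "l \<in> {1..k}" for l using that m by auto
  let ?xs = "map c [1..<Suc n] @ [2 * j - 1, 2 * j]" and ?ys = "map c [Suc n..<2 * n] @ [2 * i - 1, 2 * i]"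
  have setC: "set (map c [1..<Suc n]) = c ` {1..n}" "set (map c [Suc n..<2 * n]) = c ` {n + 1..2 * n - 1}"
  proof -
    have "{Suc n..<2 * n} = {n + 1..2 * n - 1}" by auto
    then show "set (map c [Suc n..<2 * n]) = c ` {n + 1..2 * n - 1}" by simp
  qed (simp del: upt_Suc add: atLeastLessThanSuc_atLeastAtMost)
  have "{1..n} \<subseteq> {1..2 * n - 1}" "{n + 1..2 * n - 1} \<subseteq> {1..2 * n - 1}" using m(2) by auto
  then have C1: "c ` {1..n} \<subseteq> {1..m}" and C2: "c ` {n + 1..2 * n - 1} \<subseteq> {1..m}" using c(2) by blast+
  have "c ` ({1..n} \<inter> {n + 1..2 * n - 1}) = c ` {1..n} \<inter> c ` {n + 1..2 * n - 1}"
    by (rule inj_on_image_Int[OF c(1)]) fact+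
  then have C12: "c ` {1..n} \<inter> c ` {n + 1..2 * n - 1} = {}" by auto
  have xs: "set ?xs = c ` {1..n} \<union> {2 * j - 1, 2 * j}" unfolding set_append setC by simp
  have "D j \<noteq> 0" using ij linear_0[OF linear_poisson(2)] by (metis scaleR_zero_right)
  moreover have "set ?xs \<subseteq> {1..m}" unfolding xs using C1 pair[OF j] by blast
  moreover have "m = length ?xs + 1" using m by simp
  ultimately obtain r t where t: "t \<in> {1..m}" "set ?xs = {1..m} - {t}" "D j = \<iota> (r *\<^sub>R \<xi> t)"
    using contract_basis_S1[OF \<xi> L] unfolding D_def by metis
  have "poisson (D j) (E i) = r *\<^sub>R con (\<xi> t) (E i)"
    unfolding t(3) poisson_iota_left by (rule con_scaleR_left)
  then have "contract (map \<xi> (t # ?ys)) L \<noteq> 0" using ij unfolding E_def by auto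
  then have "distinct (map \<xi> (t # ?ys))" by (metis contract_not_distinct)
  then have dist: "distinct (t # ?ys)" by (simp only: distinct_map)
  have dist_xs: "distinct ?xs"
    using \<open>D j \<noteq> 0\<close> contract_not_distinct[of "map \<xi> ?xs" L] unfolding D_def distinct_map by blast
  show ?thesis
  proof
    show "c ` {1..n} \<inter> {2 * j - 1, 2 * j} = {}"
      using dist_xs setC(1) unfolding distinct_append by (simp del: upt_Suc)
    have "t \<notin> c ` {n + 1..2 * n - 1}" "c ` {n + 1..2 * n - 1} \<inter> {2 * i - 1, 2 * i} = {}"
      using dist setC(2) by auto
    \<comment> \<open>The inner contraction exhausts all indices except \<open>t\<close>; since the
      second block avoids both \<open>t\<close> and the first block, only the pair of
      \<open>j\<close> remains for it.\<close>
    moreover have "c ` {n + 1..2 * n - 1} \<subseteq> c ` {1..n} \<union> {2 * j - 1, 2 * j} \<union> {t}"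
      using C2 t(2) unfolding xs by blast
    ultimately show "c ` {n + 1..2 * n - 1} \<subseteq> {2 * j - 1, 2 * j} - {2 * i - 1, 2 * i}"
      using C12 by blast
  qed (use i j ij in auto)
qed

lemma jacobi_identity_if:
  assumes \<xi>: "orthonormal_basis m \<xi>" and L: "L \<in> ext_pow m" and m: "m = n + 3" "n \<ge> 2" "2 * k \<le> m"
    and \<mu>: "\<mu> = (\<Sum>j = 1..k. a j *\<^sub>R con (\<xi> (2 * j - 1)) (con (\<xi> (2 * j)) L))"
    and cond: "n \<ge> 4 \<or> (\<forall>i\<in>{1..k}. \<forall>j\<in>{1..k}. i \<noteq> j \<longrightarrow> a i = 0 \<or> a j = 0)"
  shows "jacobi_identity n \<mu>"
  unfolding jacobi_identity_iff
proof
  fix b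
  have n0: "n \<noteq> 0" using m(2) by simp
  show "nested.shuffle_sum n \<mu> b = 0"
  proof (rule nested.shuffle_sum_eq_0)
    show "span (\<xi> ` {1..m}) = UNIV" using \<xi> by (simp add: orthonormal_basis_def)
    fix c assume c: "c ` {1..2 * n - 1} \<subseteq> {1..m}" "inj_on c {1..2 * n - 1}"
    show "nested_mult n \<mu> (\<xi> \<circ> c) = 0"
    proof (rule ccontr)
      assume "nested_mult n \<mu> (\<xi> \<circ> c) \<noteq> 0"
      then obtain i j where ij: "i \<in> {1..k}" "j \<in> {1..k}" "a i \<noteq> 0" "a j \<noteq> 0"
        and sub: "c ` {n + 1..2 * n - 1} \<subseteq> {2 * j - 1, 2 * j} - {2 * i - 1, 2 * i}"
        using nested_mult_basis_nonzero[OF \<xi> L m(1) n0 m(3) \<mu> c(2,1)] by metis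
      have "inj_on c {n + 1..2 * n - 1}" using c(2) by (rule inj_on_subset) auto
      from card_image[OF this] have "card (c ` {n + 1..2 * n - 1}) = n - 1" by simp
      moreover have "card (c ` {n + 1..2 * n - 1}) \<le> card {2 * j - 1, 2 * j}"
        using sub by (intro card_mono) auto
      moreover have "card {2 * j - 1, 2 * j} \<le> 2" by (simp add: card_insert_if)
      ultimately have "n < 4" by linarith
      \<comment> \<open>The second block is nonempty because \<open>n \<ge> 2\<close>; it lies in
        the pair of \<open>j\<close> and avoids that of \<open>i\<close>, which forces
        \<open>i \<noteq> j\<close>.\<close>
      have "n + 1 \<in> {n + 1..2 * n - 1}" using m(2) by auto
      then have "c (n + 1) \<in> {2 * j - 1, 2 * j} - {2 * i - 1, 2 * i}" using sub by blast
      then have "i \<noteq> j" by auto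
      with ij cond \<open>n < 4\<close> show False by (metis not_le)
    qed
  qed
qed

text \<open>For a fixed family of distinct basis vectors, a surviving term has its first block
  determined by \<open>j\<close>. So only a few subsets have to be examined in the
  counterexamples.\<close>

lemma signed_basis_nonzero:
  assumes \<xi>: "orthonormal_basis m \<xi>" and L: "L \<in> ext_pow m" and m: "m = n + 3" "n \<noteq> 0" "2 * k \<le> m"
    and \<mu>: "\<mu> = (\<Sum>j = 1..k. a j *\<^sub>R con (\<xi> (2 * j - 1)) (con (\<xi> (2 * j)) L))"
    and c: "inj_on c {1..2 * n - 1}" "c ` {1..2 * n - 1} \<subseteq> {1..m}" and \<sigma>: "\<sigma> permutes {1..2 * n - 1}"
    and nz: "nested.signed n \<mu> (\<xi> \<circ> c) \<sigma> \<noteq> 0"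
  obtains j where "j \<in> {1..k}" "\<sigma> ` {1..n} = {x \<in> {1..2 * n - 1}. c x \<notin> {2 * j - 1, 2 * j}}"
proof -
  let ?N = "{1..2 * n - 1}" and ?J = "{n + 1..2 * n - 1}"
  have 1: "inj_on (c \<circ> \<sigma>) ?N"
    using permutes_inj_on[OF \<sigma>] by (rule comp_inj_on) (simp only: permutes_image[OF \<sigma>] c(1))
  have 2: "(c \<circ> \<sigma>) ` ?N \<subseteq> {1..m}"
    using c(2) by (simp only: image_comp[symmetric] permutes_image[OF \<sigma>])
  have 3: "nested_mult n \<mu> (\<xi> \<circ> (c \<circ> \<sigma>)) \<noteq> 0"
  proof
    assume "nested_mult n \<mu> (\<xi> \<circ> (c \<circ> \<sigma>)) = 0"
    then have "nested.signed n \<mu> (\<xi> \<circ> c) \<sigma> = 0"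
      by (simp only: nested.signed_def comp_assoc scaleR_zero_right)
    with nz show False ..
  qed
  obtain i j where j: "j \<in> {1..k}" "(c \<circ> \<sigma>) ` {1..n} \<inter> {2 * j - 1, 2 * j} = {}"
    and sub: "(c \<circ> \<sigma>) ` ?J \<subseteq> {2 * j - 1, 2 * j} - {2 * i - 1, 2 * i}"
    by (rule nested_mult_basis_nonzero[OF \<xi> L m \<mu> 1 2 3])
  have "?J = ?N - {1..n}" using m(2) by auto
  then have "\<sigma> ` ?J = ?N - \<sigma> ` {1..n}"
    using permutes_image[OF \<sigma>] by (simp only: image_set_diff[OF permutes_inj[OF \<sigma>]])
  then have "c ` (?N - \<sigma> ` {1..n}) \<subseteq> {2 * j - 1, 2 * j}" "c ` \<sigma> ` {1..n} \<inter> {2 * j - 1, 2 * j} = {}"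
    using j(2) sub unfolding image_comp[symmetric] by (blast, blast)
  moreover have "\<sigma> ` {1..n} \<subseteq> ?N"
    using m(2) unfolding image_subset_iff permutes_in_image[OF \<sigma>] by auto
  ultimately have "\<sigma> ` {1..n} = {x \<in> ?N. c x \<notin> {2 * j - 1, 2 * j}}" by blast
  with j(1) show ?thesis by (rule that)
qed

section \<open>Explicit failures in dimensions 5 and 6\<close>

lemma not_jacobi_identity_5:
  assumes \<xi>: "orthonormal_basis 5 \<xi>" and L: "L = top_form 5 \<xi>"
    and \<mu>: "\<mu> = (\<Sum>j = 1..2. a j *\<^sub>R con (\<xi> (2 * j - 1)) (con (\<xi> (2 * j)) L))"
    and a: "a 1 \<noteq> 0" "a 2 \<noteq> 0"
  shows "\<not> jacobi_identity 2 \<mu>"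
proof -
  \<comment> \<open>The indices are 1, 3, 4. The odd permutation \<open>?\<sigma>\<close> represents
    the subset \<open>{2, 3}\<close> and orders the arguments as \<open>\<xi> 4\<close>,
    \<open>\<xi> 3\<close> inside and \<open>\<xi> 1\<close> outside.\<close>
  define c :: "nat \<Rightarrow> nat" where "c i = (if i = 1 then 1 else i + 1)" for i
  let ?\<sigma> = "Transposition.transpose 1 3 :: nat \<Rightarrow> nat"
  have inner: "\<xi> i \<bullet> \<xi> j = (if i = j then 1 else 0)" if "i \<in> {1..5}" "j \<in> {1..5}" for i j
    using orthonormal_basis_inner[OF \<xi>] that by simp
  have c: "inj_on c {1..2 * 2 - 1}" "c ` {1..2 * 2 - 1} \<subseteq> {1..5}"
    by (auto simp: c_def inj_on_def)
  have "nested.shuffle_sum 2 \<mu> (\<xi> \<circ> c) = (\<Sum>A\<in>{{2, 3::nat}}. nested.signed 2 \<mu> (\<xi> \<circ> c) ?\<sigma>)"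
  proof (rule nested.shuffle_sum_support[where p = "\<lambda>_. ?\<sigma>"])
    fix \<sigma> :: "nat \<Rightarrow> nat"
    assume \<sigma>: "\<sigma> permutes {1..2 * 2 - 1}" and card: "card (\<sigma> ` {1..2}) = 2" and notin: "\<sigma> ` {1..2} \<notin> {{2, 3}}"
    show "nested.signed 2 \<mu> (\<xi> \<circ> c) \<sigma> = 0"
    proof (rule ccontr)
      assume nz: "nested.signed 2 \<mu> (\<xi> \<circ> c) \<sigma> \<noteq> 0"
      obtain j where j: "j \<in> {1..2}" and A: "\<sigma> ` {1..2} = {x \<in> {1..2 * 2 - 1}. c x \<notin> {2 * j - 1, 2 * j}}"
        by (rule signed_basis_nonzero[OF \<xi> top_form_S _ _ _ \<mu>[unfolded L] c \<sigma> nz]) simp_all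
      from j consider "j = 1" | "j = 2" by fastforce
      then show False
      proof cases
        case 1
        then have "\<sigma> ` {1..2} = {2, 3}" unfolding A c_def by auto
        with notin show False by simp
      next
        \<comment> \<open>The pair 3, 4 would leave only one position for the first block, which
          needs two.\<close>
        case 2
        then have "\<sigma> ` {1..2} = {1}" unfolding A c_def by auto
        with card show False by simp
      qed
    qed
  next
    show "?\<sigma> permutes {1..2 * 2 - 1} \<and> ?\<sigma> ` {1..2} = A" if "A \<in> {{2, 3}}" for A
    proof
      have "{1..2} = {1, 2::nat}" by auto
      then show "?\<sigma> ` {1..2} = A" using that by auto
    qed (rule permutes_swap_id; simp)
  qed auto
  also have "\<dots> = - nested_mult 2 \<mu> (\<xi> \<circ> c \<circ> ?\<sigma>)"
    by (simp add: nested.signed_def sign_swap_id)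
  also have "\<dots> = (a 1 * a 2) *\<^sub>R \<iota> (\<xi> 2)"
  proof -
    have "L = \<iota> (\<xi> 1) * (\<iota> (\<xi> 2) * (\<iota> (\<xi> 3) * (\<iota> (\<xi> 4) * \<iota> (\<xi> 5))))"
      unfolding L top_form_def by (simp add: upt_rec numeral_eq_Suc mult.assoc)
    moreover have "\<mu> = a 1 *\<^sub>R con (\<xi> 1) (con (\<xi> 2) L) + a 2 *\<^sub>R con (\<xi> 3) (con (\<xi> 4) L)"
    proof -
      have "{1..2} = {1, 2::nat}" by auto
      then show ?thesis unfolding \<mu> by simp
    qed
    ultimately have \<mu>': "\<mu> = - a 1 *\<^sub>R (\<iota> (\<xi> 3) * (\<iota> (\<xi> 4) * \<iota> (\<xi> 5))) - a 2 *\<^sub>R (\<iota> (\<xi> 1) * (\<iota> (\<xi> 2) * \<iota> (\<xi> 5)))"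
      by (simp add: con_mult con_add con_scaleR con_linear_simps hat_mult inner)
    have "contract [\<xi> 4, \<xi> 3] \<mu> = - a 1 *\<^sub>R \<iota> (\<xi> 5)"
      unfolding \<mu>' by (simp add: con_mult con_add con_scaleR con_linear_simps hat_mult inner)
    moreover have "contract [\<xi> 1] \<mu> = - a 2 *\<^sub>R (\<iota> (\<xi> 2) * \<iota> (\<xi> 5))"
      unfolding \<mu>' by (simp add: con_mult con_add con_scaleR con_linear_simps hat_mult inner)
    moreover have "map (\<xi> \<circ> c \<circ> ?\<sigma>) [1..<Suc 2] = [\<xi> 4, \<xi> 3]" "map (\<xi> \<circ> c \<circ> ?\<sigma>) [Suc 2..<2 * 2] = [\<xi> 1]"
      by (simp_all add: upt_rec numeral_eq_Suc c_def Transposition.transpose_def)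
    ultimately show ?thesis
      unfolding nested_mult_def
      by (simp add: linear_scale[OF linear_poisson(2)] linear_neg[OF linear_poisson(2)] poisson_iota_left
          con_mult con_scaleR con_linear_simps inner del: foldr.simps)
  qed
  \<comment> \<open>Contracting with \<open>\<xi> 2\<close> turns the value into the scalar
    \<open>a 1 * a 2\<close>, so that nonvanishing can be read off.\<close>
  finally have "con (\<xi> 2) (nested.shuffle_sum 2 \<mu> (\<xi> \<circ> c)) = (a 1 * a 2) *\<^sub>R con (\<xi> 2) (\<iota> (\<xi> 2))"
    by (simp only: con_scaleR)
  then have "con (\<xi> 2) (nested.shuffle_sum 2 \<mu> (\<xi> \<circ> c)) \<noteq> 0"
    using a by (simp add: inner)
  then have "nested.shuffle_sum 2 \<mu> (\<xi> \<circ> c) \<noteq> 0"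
    by (metis con_linear_simps(1))
  then show ?thesis unfolding jacobi_identity_iff by blast
qed

text \<open>The coefficient \<open>a 3\<close> is arbitrary, so both exceptional families in
  dimension 6 are covered.\<close>

lemma not_jacobi_identity_6:
  assumes \<xi>: "orthonormal_basis 6 \<xi>" and L: "L = top_form 6 \<xi>"
    and \<mu>: "\<mu> = (\<Sum>j = 1..3. a j *\<^sub>R con (\<xi> (2 * j - 1)) (con (\<xi> (2 * j)) L))"
    and a: "a 1 \<noteq> 0" "a 2 \<noteq> 0"
  shows "\<not> jacobi_identity 3 \<mu>"
proof -
  \<comment> \<open>The indices are 1, 2, 3, 4, 6. The arguments are ordered by
    \<open>\<sigma>\<close> as 1, 2, 6 inside and 4, 3 outside, and by \<open>\<tau>\<close> as 3,
    4, 6 inside and 2, 1 outside; both permutations are odd.\<close>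
  define c :: "nat \<Rightarrow> nat" where "c i = (if i \<le> 4 then i else 6)" for i
  define \<sigma> where "\<sigma> = (Transposition.transpose 3 5 :: nat \<Rightarrow> nat)"
  define \<tau> where "\<tau> = Transposition.transpose 1 3 \<circ> Transposition.transpose 2 4 \<circ> \<sigma>"
  have inner: "\<xi> i \<bullet> \<xi> j = (if i = j then 1 else 0)" if "i \<in> {1..6}" "j \<in> {1..6}" for i j
    using orthonormal_basis_inner[OF \<xi>] that by simp
  have c: "inj_on c {1..2 * 3 - 1}" "c ` {1..2 * 3 - 1} \<subseteq> {1..6}"
    by (auto simp: c_def inj_on_def)
  have perm: "\<sigma> permutes {1..2 * 3 - 1}" "\<tau> permutes {1..2 * 3 - 1}"
    unfolding \<tau>_def \<sigma>_def by (intro permutes_compose permutes_swap_id; simp)+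
  have sign: "sign \<sigma> = - 1" "sign \<tau> = - 1"
    by (simp_all add: \<tau>_def \<sigma>_def sign_compose permutation_swap_id permutation_compose sign_swap_id del: comp_apply)
  have image: "\<sigma> ` {1..3} = {1, 2, 5}" "\<tau> ` {1..3} = {3, 4, 5}"
  proof -
    have "{1..3} = {1, 2, 3::nat}" by auto
    then show "\<sigma> ` {1..3} = {1, 2, 5}" "\<tau> ` {1..3} = {3, 4, 5}"
      by (auto simp: \<tau>_def \<sigma>_def Transposition.transpose_def)
  qed
  define p where "p A = (if A = {1, 2, 5} then \<sigma> else \<tau>)" for A :: "nat set"
  have "nested.shuffle_sum 3 \<mu> (\<xi> \<circ> c) = (\<Sum>A\<in>{{1, 2, 5}, {3, 4, 5}}. nested.signed 3 \<mu> (\<xi> \<circ> c) (p A))"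
  proof (rule nested.shuffle_sum_support)
    fix \<pi> :: "nat \<Rightarrow> nat"
    assume \<pi>: "\<pi> permutes {1..2 * 3 - 1}" and card: "card (\<pi> ` {1..3}) = 3"
      and notin: "\<pi> ` {1..3} \<notin> {{1, 2, 5}, {3, 4, 5}}"
    show "nested.signed 3 \<mu> (\<xi> \<circ> c) \<pi> = 0"
    proof (rule ccontr)
      assume nz: "nested.signed 3 \<mu> (\<xi> \<circ> c) \<pi> \<noteq> 0"
      obtain j where j: "j \<in> {1..3}" and A: "\<pi> ` {1..3} = {x \<in> {1..2 * 3 - 1}. c x \<notin> {2 * j - 1, 2 * j}}"
        by (rule signed_basis_nonzero[OF \<xi> top_form_S _ _ _ \<mu>[unfolded L] c \<pi> nz]) simp_all
      from j consider "j = 1" | "j = 2" | "j = 3" by fastforce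
      then show False
      proof cases
        case 1
        then have "\<pi> ` {1..3} = {3, 4, 5}" unfolding A c_def by auto
        with notin show False by simp
      next
        case 2
        then have "\<pi> ` {1..3} = {1, 2, 5}" unfolding A c_def by auto
        with notin show False by simp
      next
        \<comment> \<open>The pair 5, 6 meets the family only in index 6, so four positions would be
          left for a first block of three.\<close>
        case 3
        then have "\<pi> ` {1..3} = {1, 2, 3, 4}" unfolding A c_def by auto
        with card show False by simp
      qed
    qed
  next
    show "p A permutes {1..2 * 3 - 1} \<and> p A ` {1..3} = A" if "A \<in> {{1, 2, 5}, {3, 4, 5}}" for A
      using that perm image unfolding p_def by auto
  qed auto
  also have "\<dots> = - nested_mult 3 \<mu> (\<xi> \<circ> c \<circ> \<sigma>) - nested_mult 3 \<mu> (\<xi> \<circ> c \<circ> \<tau>)"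
  proof -
    \<comment> \<open>The element 3 separates the two subsets, so the sum has two terms and
      \<open>p\<close> selects \<open>\<tau>\<close> for the second.\<close>
    have "3 \<in> {3, 4, 5::nat}" "3 \<notin> {1, 2, 5::nat}" by simp_all
    then have "{3, 4, 5} \<noteq> {1, 2, 5::nat}" by metis
    then show ?thesis by (simp add: p_def nested.signed_def sign)
  qed
  also have "\<dots> = (- (a 1 * a 2)) *\<^sub>R \<iota> (\<xi> 6) + (- (a 1 * a 2)) *\<^sub>R \<iota> (\<xi> 6)"
  proof -
    have "L = \<iota> (\<xi> 1) * (\<iota> (\<xi> 2) * (\<iota> (\<xi> 3) * (\<iota> (\<xi> 4) * (\<iota> (\<xi> 5) * \<iota> (\<xi> 6)))))"
      unfolding L top_form_def by (simp add: upt_rec numeral_eq_Suc mult.assoc)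
    moreover have "\<mu> = a 1 *\<^sub>R con (\<xi> 1) (con (\<xi> 2) L) + a 2 *\<^sub>R con (\<xi> 3) (con (\<xi> 4) L)
        + a 3 *\<^sub>R con (\<xi> 5) (con (\<xi> 6) L)"
    proof -
      have "{1..3} = {1, 2, 3::nat}" by auto
      then show ?thesis unfolding \<mu> by (simp add: add.assoc)
    qed
    ultimately have \<mu>': "\<mu> = - a 1 *\<^sub>R (\<iota> (\<xi> 3) * (\<iota> (\<xi> 4) * (\<iota> (\<xi> 5) * \<iota> (\<xi> 6))))
        - a 2 *\<^sub>R (\<iota> (\<xi> 1) * (\<iota> (\<xi> 2) * (\<iota> (\<xi> 5) * \<iota> (\<xi> 6))))
        - a 3 *\<^sub>R (\<iota> (\<xi> 1) * (\<iota> (\<xi> 2) * (\<iota> (\<xi> 3) * \<iota> (\<xi> 4))))"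
      by (simp add: con_mult con_add con_scaleR con_linear_simps hat_mult inner)
    note con_simps = con_mult con_add con_scaleR con_linear_simps hat_mult inner
    have "contract [\<xi> 1, \<xi> 2, \<xi> 6] \<mu> = - a 2 *\<^sub>R \<iota> (\<xi> 5)"
      "contract [\<xi> 4, \<xi> 3] \<mu> = - a 1 *\<^sub>R (\<iota> (\<xi> 5) * \<iota> (\<xi> 6)) - a 3 *\<^sub>R (\<iota> (\<xi> 1) * \<iota> (\<xi> 2))"
      "contract [\<xi> 3, \<xi> 4, \<xi> 6] \<mu> = - a 1 *\<^sub>R \<iota> (\<xi> 5)"
      "contract [\<xi> 2, \<xi> 1] \<mu> = - a 2 *\<^sub>R (\<iota> (\<xi> 5) * \<iota> (\<xi> 6)) - a 3 *\<^sub>R (\<iota> (\<xi> 3) * \<iota> (\<xi> 4))"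
      unfolding \<mu>' by (simp_all add: con_simps)
    moreover have "map (\<xi> \<circ> c \<circ> \<sigma>) [1..<Suc 3] = [\<xi> 1, \<xi> 2, \<xi> 6]" "map (\<xi> \<circ> c \<circ> \<sigma>) [Suc 3..<2 * 3] = [\<xi> 4, \<xi> 3]"
      "map (\<xi> \<circ> c \<circ> \<tau>) [1..<Suc 3] = [\<xi> 3, \<xi> 4, \<xi> 6]" "map (\<xi> \<circ> c \<circ> \<tau>) [Suc 3..<2 * 3] = [\<xi> 2, \<xi> 1]"
      by (simp_all add: upt_rec numeral_eq_Suc c_def \<tau>_def \<sigma>_def Transposition.transpose_def)
    ultimately show ?thesis
      unfolding nested_mult_def
      by (simp add: linear_scale[OF linear_poisson(2)] linear_neg[OF linear_poisson(2)] poisson_iota_left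
          con_simps mult.commute del: foldr.simps)
  qed
  also have "\<dots> = (- 2 * a 1 * a 2) *\<^sub>R \<iota> (\<xi> 6)"
    by (simp only: scaleR_left_distrib[symmetric]) simp
  finally have "con (\<xi> 6) (nested.shuffle_sum 3 \<mu> (\<xi> \<circ> c)) = (- 2 * a 1 * a 2) *\<^sub>R con (\<xi> 6) (\<iota> (\<xi> 6))"
    by (simp only: con_scaleR)
  then have "con (\<xi> 6) (nested.shuffle_sum 3 \<mu> (\<xi> \<circ> c)) \<noteq> 0"
    using a by (simp add: inner)
  then have "nested.shuffle_sum 3 \<mu> (\<xi> \<circ> c) \<noteq> 0"
    by (metis con_linear_simps(1))
  then show ?thesis unfolding jacobi_identity_iff by blast
qed

theorem theorem6:
  fixes \<xi> :: "nat \<Rightarrow> 'v::euclidean_space" and a :: "nat \<Rightarrow> real" and m k :: nat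
  assumes "DIM('v) = m" and "m > 4"
    and "orthonormal_basis m \<xi>"
    and "(m = 2 * k + 1 \<and> 0 \<le> a k \<and> (\<forall>j\<in>{1..<k}. a (j + 1) \<le> a j)) \<or>
         (m = 2 * k \<and> \<bar>a k\<bar> \<le> a (k - 1) \<and> (\<forall>j\<in>{1..<k - 1}. a (j + 1) \<le> a j))"
  shows "jacobi_identity (m - 3)
           (star (top_form m \<xi>) (\<Sum>j = 1..k. a j *\<^sub>R (\<iota> (\<xi> (2 * j - 1)) * \<iota> (\<xi> (2 * j)))))
         \<longleftrightarrow>
         \<not> ((m = 5 \<and> a 1 \<noteq> 0 \<and> a 2 \<noteq> 0) \<or>
            (m = 6 \<and> a 1 \<noteq> 0 \<and> a 2 \<noteq> 0 \<and> a 3 = 0) \<or>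
            (m = 6 \<and> a 1 \<noteq> 0 \<and> a 2 \<noteq> 0 \<and> a 3 \<noteq> 0))"
proof -
  let ?\<mu> = "\<Sum>j = 1..k. a j *\<^sub>R con (\<xi> (2 * j - 1)) (con (\<xi> (2 * j)) (top_form m \<xi>))"
  have k: "2 * k \<le> m" "m \<le> 2 * k + 1" using assms(4) by auto
  have if_cond: "jacobi_identity (m - 3) ?\<mu>"
    if "m \<ge> 7 \<or> (\<forall>i\<in>{1..k}. \<forall>j\<in>{1..k}. i \<noteq> j \<longrightarrow> a i = 0 \<or> a j = 0)"
    by (rule jacobi_identity_if[OF assms(3) top_form_S _ _ k(1) refl]) (use that assms(2) in auto)
  consider "m = 5" "k = 2" | "m = 6" "k = 3" | "m \<ge> 7"
    using assms(2) k by linarith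
  \<comment> \<open>The two exceptional cases for \<open>m = 6\<close> differ only in whether
    \<open>a 3\<close> vanishes and merge into one condition.\<close>
  then have "jacobi_identity (m - 3) ?\<mu> \<longleftrightarrow> \<not> ((m = 5 \<or> m = 6) \<and> a 1 \<noteq> 0 \<and> a 2 \<noteq> 0)"
  proof cases
    case 1
    have "{1..k} = {1, 2}" using 1 by auto
    with 1 if_cond have "a 1 = 0 \<or> a 2 = 0 \<Longrightarrow> jacobi_identity 2 ?\<mu>" by auto
    with 1 not_jacobi_identity_5[OF _ refl refl, of \<xi> a] assms(3) show ?thesis by auto
  next
    case 2
    have "{1..k} = {1, 2, 3}" using 2 by auto
    \<comment> \<open>By the chain \<open>\<bar>a 3\<bar> \<le> a 2 \<le> a 1\<close>, if
      \<open>a 1\<close> or \<open>a 2\<close> vanishes then so do \<open>a 2\<close> and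
      \<open>a 3\<close>, and at most one coefficient is nonzero.\<close>
    have "\<bar>a 3\<bar> \<le> a 2" and mono: "\<forall>j\<in>{1..<2}. a (j + 1) \<le> a j" using assms(4) 2 by auto
    moreover have "a 2 \<le> a 1" using bspec[OF mono, of 1] by (simp add: numeral_2_eq_2)
    ultimately have "a 2 = 0 \<and> a 3 = 0" if "a 1 = 0 \<or> a 2 = 0" using that by auto
    with 2 if_cond \<open>{1..k} = {1, 2, 3}\<close> have "a 1 = 0 \<or> a 2 = 0 \<Longrightarrow> jacobi_identity 3 ?\<mu>" by auto
    with 2 not_jacobi_identity_6[OF _ refl refl, of \<xi> a] assms(3) show ?thesis by auto
  next
    case 3
    with if_cond show ?thesis by auto
  qed
  then show ?thesis unfolding star_two_vectors by blast
qed

end
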